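(* Let $\delta,\alpha_1,\alpha_2,\alpha_3\in\mathbb C$ with $\delta\ne 0$ and $2\alpha_j\notin\mathbb Z$ $(j=1,2,3)$. Let $y(x)$ be a solution of the sixth Painlevé equation $\mathrm{P_{VI}}$ with parameters $\delta,\alpha_1,\alpha_2,\alpha_3$, let $a\in\mathbb C\setminus\{0,1\}$ be a pole of $y(x)$, and let $\Psi_\lambda=A(\lambda)\Psi$, $A(\lambda)=A(\lambda,x)$, be the linear $2\times 2$ Fuchsian system associated with $y(x)$. Then at the pole $x=a$ this linear system is equivalent (in some cases after a suitable regularization), in the sense defined in the context, to the general Heun equation $$\frac{d^2u}{d\lambda^2}+\Big(\frac{\gamma}{\lambda}+\frac{\eta}{\lambda-1}+\frac{\epsilon}{\lambda-a}\Big)\frac{du}{d\lambda}+\frac{\alpha\beta\lambda-q}{\lambda(\lambda-1)(\lambda-a)}u=0,\qquad \gamma+\eta+\epsilon=\alpha+\beta+1 .$$ Moreover, the position $a$ of the pole is the position of the fourth singular point of this Heun equation, and the free parameter of the Laurent expansion of $y(x)$ at $x=a$ determines its accessory parameter $q$ (for given $\delta,\alpha_1,\alpha_2,\alpha_3$, given $a$ and given type of the pole).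
   Context: Notation: $\sigma_3=\begin{pmatrix}1&0\\0&-1\end{pmatrix}$, $\sigma_+=\begin{pmatrix}0&1\\0&0\end{pmatrix}$, $\sigma_-=\begin{pmatrix}0&0\\1&0\end{pmatrix}$. The equation $\mathrm{P_{VI}}$ with parameters $\delta,\alpha_1,\alpha_2,\alpha_3$ is $$y_{xx}=\tfrac12\Big(\tfrac1y+\tfrac1{y-1}+\tfrac1{y-x}\Big)y_x^2-\Big(\tfrac1x+\tfrac1{x-1}+\tfrac1{y-x}\Big)y_x+\frac{y(y-1)(y-x)}{x^2(x-1)^2}\Big\{2(\delta-\tfrac12)^2-2\alpha_1^2\frac{x}{y^2}+2\alpha_3^2\frac{x-1}{(y-1)^2}-2(\alpha_2^2-\tfrac14)\frac{x(x-1)}{(y-x)^2}\Big\}.$$ Associated linear system. Given a solution $y(x)$, put $z=\frac12\big(x(x-1)y_x-y^2+y\big)$ and let $\kappa(x)$ be a nonzero solution of $\frac{d\ln\kappa}{dx}=(2\delta-1)\frac{y-x}{x(x-1)}$. The associated linear system is $\Psi_\lambda=A(\lambda)\Psi$ with $$A(\lambda)=\frac{-\delta(\lambda-y)^2+p(\lambda-y)+z}{\lambda(\lambda-1)(\lambda-x)}\sigma_3+\frac{\kappa(\lambda-y)}{\lambda(\lambda-1)(\lambda-x)}\sigma_++\frac{N(\lambda)}{\lambda(\lambda-1)(\lambda-x)}\sigma_-,$$ where $p=p(x)$ and the polynomial $N(\lambda)=N(\lambda,x)$ of degree at most $1$ in $\lambda$ are uniquely determined (for $y\neq 0,1,x$)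 by the requirement that the residues of $A(\lambda)$ at $\lambda=0$, $\lambda=x$, $\lambda=1$ have eigenvalues $\pm\alpha_1$, $\pm\alpha_2$, $\pm\alpha_3$ respectively. (Thus $A=\frac{A_1}{\lambda}+\frac{A_2}{\lambda-x}+\frac{A_3}{\lambda-1}$, $A_1+A_2+A_3=-\delta\sigma_3$, $\operatorname{Tr}A\equiv0$, and $y$ is the zero of $A_{12}$.) Laurent expansions at poles $a\in\mathbb C\setminus\{0,1\}$. If $\delta\ne\frac12$, poles are simple, $y(x)=c_{-1}(x-a)^{-1}+c_0+c_1(x-a)+\cdots$ with $c_{-1}=\sigma\frac{a(a-1)}{2(\delta-1/2)}$, $\sigma\in\{1,-1\}$; the coefficient $c_0\in\mathbb C$ is the free parameter (all further coefficients are determined by $a$, $c_0$, $\sigma$, $\delta$, $\alpha_j$), and $\sigma$ is the type of the pole. If $\delta=\frac12$, poles are double, $y(x)=c_{-2}(x-a)^{-2}+c_{-1}(x-a)^{-1}+c_0+\cdots$, where $c_{-2}\in\mathbb C\setminus\{0\}$ is the free parameter (all other coefficients are determined by $a$, $c_{-2}$, $\alpha_j$), and there is only one type. Equivalence at the pole (possibly after regularization) means: there is a gauge matrix $R(\lambda,x)$ with $\det R\equiv1$ (a Schlesinger transformation), defined for $x$ near $a$, $x\ne a$, of the form $\lambda^{-m/2}$ ($m\in\{0,1\}$) times a matrix polynomial in $\lambda$ (with $R=I$ allowed, i.e. no regularization), such that $\hat A=RAR^{-1}+R_\lambda R^{-1}$ has a limit $\hat A_a(\lambda)$ as $x\to a$;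 and there are a row index $i\in\{1,2\}$ and exponents $p_1,p_2,p_3\in\mathbb C$ such that the map $\Phi\mapsto u=\lambda^{p_1}(\lambda-a)^{p_2}(\lambda-1)^{p_3}\Phi_i$ is a bijection from the space of local vector solutions $\Phi=(\Phi_1,\Phi_2)^{T}$ of $\Phi_\lambda=\hat A_a(\lambda)\Phi$ onto the space of local solutions $u$ of the general Heun equation, with the parameters $\gamma,\eta,\epsilon,\alpha,\beta$ depending only on $\delta,\alpha_1,\alpha_2,\alpha_3$ and the type of the pole. *)

theory Defs
  imports "HOL-Complex_Analysis.Complex_Analysis"
begin

section \<open>The sixth Painleve equation\<close>

text \<open>
  Solutions are holomorphic on an open set; a pole is an isolated singularity of that set.
  At the isolated points where y takes one of the values 0, 1, x the equation is singular
  and nothing is required; the third conjunct excludes that y is identically 0, 1 or x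
  on a component.
\<close>

definition P6_equation ::
  "complex \<Rightarrow> complex \<Rightarrow> complex \<Rightarrow> complex \<Rightarrow> (complex \<Rightarrow> complex) \<Rightarrow> complex \<Rightarrow> bool" where
  "P6_equation \<delta> \<alpha>1 \<alpha>2 \<alpha>3 y x \<longleftrightarrow>
     deriv (deriv y) x =
       1/2 * (1 / y x + 1 / (y x - 1) + 1 / (y x - x)) * (deriv y x)^2
       - (1 / x + 1 / (x - 1) + 1 / (y x - x)) * deriv y x
       + y x * (y x - 1) * (y x - x) / (x^2 * (x - 1)^2) *
           (2 * (\<delta> - 1/2)^2 - 2 * \<alpha>1^2 * (x / (y x)^2)
            + 2 * \<alpha>3^2 * ((x - 1) / (y x - 1)^2)
            - 2 * (\<alpha>2^2 - 1/4) * (x * (x - 1) / (y x - x)^2))"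

definition P6_solution_on ::
  "complex \<Rightarrow> complex \<Rightarrow> complex \<Rightarrow> complex \<Rightarrow> complex set \<Rightarrow> (complex \<Rightarrow> complex) \<Rightarrow> bool" where
  "P6_solution_on \<delta> \<alpha>1 \<alpha>2 \<alpha>3 S y \<longleftrightarrow>
     open S \<and> S \<inter> {0, 1} = {} \<and> y holomorphic_on S \<and>
     (\<forall>x\<in>S. \<forall>\<^sub>F w in at x. y w \<notin> {0, 1, w}) \<and>
     (\<forall>x\<in>S. y x \<notin> {0, 1, x} \<longrightarrow> P6_equation \<delta> \<alpha>1 \<alpha>2 \<alpha>3 y x)"

text \<open>
  The type and the free parameter of a pole. For \<open>\<delta> \<noteq> 1/2\<close> the type is the \<open>\<sigma>\<close> with
  \<open>c\<^sub>-\<^sub>1 = \<sigma> a (a - 1) / (2 (\<delta> - 1/2))\<close> and the free parameter is \<open>c\<^sub>0\<close>; for \<open>\<delta> = 1/2\<close> there is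
  a single type, encoded as 1, and the free parameter is \<open>c\<^sub>-\<^sub>2\<close>.
\<close>

definition pole_type :: "complex \<Rightarrow> complex \<Rightarrow> (complex \<Rightarrow> complex) \<Rightarrow> complex" where
  "pole_type \<delta> a y =
     (if \<delta> = 1/2 then 1
      else fls_nth (laurent_expansion y a) (-1) * (2 * (\<delta> - 1/2)) / (a * (a - 1)))"

definition pole_parameter :: "complex \<Rightarrow> complex \<Rightarrow> (complex \<Rightarrow> complex) \<Rightarrow> complex" where
  "pole_parameter \<delta> a y =
     (if \<delta> = 1/2 then fls_nth (laurent_expansion y a) (-2)
      else fls_nth (laurent_expansion y a) 0)"


section \<open>The associated linear system\<close>

definition kappa_solution_on ::
  "complex \<Rightarrow> (complex \<Rightarrow> complex) \<Rightarrow> complex set \<Rightarrow> (complex \<Rightarrow> complex) \<Rightarrow> bool" where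
  "kappa_solution_on \<delta> y S \<kappa> \<longleftrightarrow>
     (\<forall>x\<in>S. \<kappa> x \<noteq> 0 \<and>
        (\<kappa> has_field_derivative \<kappa> x * ((2 * \<delta> - 1) * ((y x - x) / (x * (x - 1))))) (at x))"

definition z_of :: "(complex \<Rightarrow> complex) \<Rightarrow> complex \<Rightarrow> complex" where
  "z_of y x = 1/2 * (x * (x - 1) * deriv y x - (y x)^2 + y x)"

text \<open>The variable \<open>t\<close> is the spectral parameter \<open>\<lambda>\<close>.\<close>

definition A_matrix ::
  "complex \<Rightarrow> (complex \<Rightarrow> complex) \<Rightarrow> (complex \<Rightarrow> complex) \<Rightarrow> (complex \<Rightarrow> complex) \<Rightarrow>
   (complex \<Rightarrow> complex poly) \<Rightarrow> complex \<Rightarrow> complex \<Rightarrow> complex^2^2" where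
  "A_matrix \<delta> y \<kappa> p N x t =
     (let T = t * (t - 1) * (t - x);
          d = (- \<delta> * (t - y x)^2 + p x * (t - y x) + z_of y x) / T
      in vector [vector [d, \<kappa> x * (t - y x) / T],
                 vector [poly (N x) t / T, - d]])"

definition residue_matrix :: "(complex \<Rightarrow> complex^2^2) \<Rightarrow> complex \<Rightarrow> complex^2^2" where
  "residue_matrix M c = (\<chi> i j. residue (\<lambda>t. M t $ i $ j) c)"

definition eigenvalues :: "complex^2^2 \<Rightarrow> complex set" where
  "eigenvalues M = {\<mu>. \<exists>v. v \<noteq> 0 \<and> M *v v = \<mu> *s v}"

definition associated_system ::
  "complex \<Rightarrow> complex \<Rightarrow> complex \<Rightarrow> complex \<Rightarrow> complex set \<Rightarrow> (complex \<Rightarrow> complex) \<Rightarrow>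
   (complex \<Rightarrow> complex \<Rightarrow> complex^2^2) \<Rightarrow> bool" where
  "associated_system \<delta> \<alpha>1 \<alpha>2 \<alpha>3 S y A \<longleftrightarrow>
     (\<exists>\<kappa> p N. kappa_solution_on \<delta> y S \<kappa> \<and> A = A_matrix \<delta> y \<kappa> p N \<and>
        (\<forall>x\<in>S. y x \<notin> {0, 1, x} \<longrightarrow>
           degree (N x) \<le> 1 \<and>
           eigenvalues (residue_matrix (A x) 0) = {\<alpha>1, - \<alpha>1} \<and>
           eigenvalues (residue_matrix (A x) x) = {\<alpha>2, - \<alpha>2} \<and>
           eigenvalues (residue_matrix (A x) 1) = {\<alpha>3, - \<alpha>3}))"


section \<open>Local solutions\<close>

text \<open>
  Local solutions are taken on an open set \<open>D\<close>; functions are made extensional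
  (undefined outside \<open>D\<close>) so that a solution is determined by its values on \<open>D\<close>.
\<close>

definition system_solutions :: "(complex \<Rightarrow> complex^2^2) \<Rightarrow> complex set \<Rightarrow> (complex \<Rightarrow> complex^2) set" where
  "system_solutions M D =
     {\<Phi> \<in> extensional D. \<forall>t\<in>D. \<forall>i.
        ((\<lambda>w. \<Phi> w $ i) has_field_derivative (M t *v \<Phi> t) $ i) (at t)}"

definition heun_solutions ::
  "complex \<Rightarrow> complex \<Rightarrow> complex \<Rightarrow> complex \<Rightarrow> complex \<Rightarrow> complex \<Rightarrow> complex \<Rightarrow> complex set \<Rightarrow>
   (complex \<Rightarrow> complex) set" where
  "heun_solutions a \<gamma> \<eta> \<epsilon> \<alpha> \<beta> q D =
     {u \<in> extensional D. u holomorphic_on D \<and>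
        (\<forall>t\<in>D. deriv (deriv u) t + (\<gamma> / t + \<eta> / (t - 1) + \<epsilon> / (t - a)) * deriv u t
           + (\<alpha> * \<beta> * t - q) / (t * (t - 1) * (t - a)) * u t = 0)}"


section \<open>Equivalence to the Heun equation at a pole\<close>

text \<open>
  Since \<open>\<lambda>\<^sup>-\<^sup>m\<^sup>/\<^sup>2\<close> and the powers of \<open>\<lambda>\<close>, \<open>\<lambda> - a\<close>, \<open>\<lambda> - 1\<close> are multivalued, the conditions below
  are imposed for all local holomorphic branches of the square root and of the logarithms.
\<close>

definition sqrt_branch :: "complex set \<Rightarrow> (complex \<Rightarrow> complex) \<Rightarrow> bool" where
  "sqrt_branch D s \<longleftrightarrow> open D \<and> 0 \<notin> D \<and> s holomorphic_on D \<and> (\<forall>t\<in>D. (s t)^2 = t)"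

definition log_branch :: "complex set \<Rightarrow> complex \<Rightarrow> (complex \<Rightarrow> complex) \<Rightarrow> bool" where
  "log_branch D c l \<longleftrightarrow> l holomorphic_on D \<and> (\<forall>t\<in>D. exp (l t) = t - c)"

definition gauge_matrix ::
  "nat \<Rightarrow> (complex \<Rightarrow> complex) \<Rightarrow> (complex poly)^2^2 \<Rightarrow> complex \<Rightarrow> complex^2^2" where
  "gauge_matrix m s P t = (\<chi> i j. poly (P $ i $ j) t / (s t)^m)"

definition gauge_transform ::
  "(complex \<Rightarrow> complex^2^2) \<Rightarrow> (complex \<Rightarrow> complex^2^2) \<Rightarrow> complex \<Rightarrow> complex^2^2" where
  "gauge_transform R A t =
     R t ** A t ** matrix_inv (R t)
     + (\<chi> i j. deriv (\<lambda>w. R w $ i $ j) t) ** matrix_inv (R t)"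

definition schlesinger_limit ::
  "(complex \<Rightarrow> complex \<Rightarrow> complex^2^2) \<Rightarrow> complex \<Rightarrow> (complex \<Rightarrow> complex^2^2) \<Rightarrow> bool" where
  "schlesinger_limit A a Aa \<longleftrightarrow>
     (\<exists>m\<in>{0, 1}. \<exists>P.
        (\<forall>\<^sub>F x in at a. \<forall>D s. sqrt_branch D s \<longrightarrow> (\<forall>t\<in>D. det (gauge_matrix m s (P x) t) = 1)) \<and>
        (\<forall>D s. sqrt_branch D s \<longrightarrow> (\<forall>t\<in>D - {1, a}.
           ((\<lambda>x. gauge_transform (gauge_matrix m s (P x)) (A x) t) \<longlongrightarrow> Aa t) (at a))))"

definition equivalent_to_heun_at ::
  "(complex \<Rightarrow> complex \<Rightarrow> complex^2^2) \<Rightarrow> complex \<Rightarrow>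
   complex \<Rightarrow> complex \<Rightarrow> complex \<Rightarrow> complex \<Rightarrow> complex \<Rightarrow> complex \<Rightarrow> bool" where
  "equivalent_to_heun_at A a \<gamma> \<eta> \<epsilon> \<alpha> \<beta> q \<longleftrightarrow>
     (\<exists>Aa. schlesinger_limit A a Aa \<and>
        (\<exists>i p1 p2 p3. \<forall>D l0 la l1.
           open D \<and> D \<inter> {0, 1, a} = {} \<and>
           log_branch D 0 l0 \<and> log_branch D a la \<and> log_branch D 1 l1 \<longrightarrow>
           bij_betw
             (\<lambda>\<Phi>. \<lambda>t\<in>D. exp (p1 * l0 t) * exp (p2 * la t) * exp (p3 * l1 t) * \<Phi> t $ i)
             (system_solutions Aa D) (heun_solutions a \<gamma> \<eta> \<epsilon> \<alpha> \<beta> q D)))"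

end

theory Submission
  imports Defs
begin

text \<open>
  Write \<open>T = t (t - 1) (t - x)\<close>. The matrix \<open>A\<close> has the numerators \<open>d\<close> on the diagonal, with
  \<open>d = z\<close> at \<open>t = y\<close>, and \<open>\<kappa> (t - y)\<close> in the upper right corner. At a pole of \<open>y\<close> these numerators
  need not converge. A gauge matrix \<open>((r, 0), (f, 1/r))\<close> with \<open>r\<^sup>2 = - 1 / (\<kappa> y)\<close> turns the upper
  right numerator into \<open>1 - t / y\<close>, which tends to 1, and a suitable \<open>f\<close>, linear in \<open>t\<close>, turns
  \<open>d\<close> into \<open>\<zeta> t\<^sup>2\<close> with \<open>\<zeta> = z / y\<^sup>2\<close>, which has the same value at \<open>t = y\<close>. The lower left numerator is then
  a cubic. Its values at \<open>0, 1, x\<close> follow from the eigenvalues of the residues, and its leading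
  coefficient is \<open>y (\<zeta> + \<delta>) (\<zeta> + 1 - \<delta>)\<close>; see \<open>gauged_numerator_interpolation\<close>. So the gauged
  matrix converges as soon as \<open>\<zeta>\<close> and this coefficient do (\<open>schlesinger_limitI\<close>), and the same
  gauge serves simple poles of both types and double poles.

  The two limits come from the Laurent expansion. The leading terms of the differential equation
  give the order of the pole and, for simple poles, the residue up to sign (\<open>P6_pole_order\<close>). Then
  \<open>\<zeta>\<close> tends to a root \<open>e\<close> of \<open>(\<zeta> + \<delta>) (\<zeta> + 1 - \<delta>)\<close>, this product vanishes at \<open>a\<close> at least
  to the order of the pole of \<open>y\<close>, and the limit \<open>l\<close> of the leading coefficient is an explicit function of the free
  parameter (\<open>simple_pole_limits\<close>, \<open>double_pole_limits\<close>).

  In the limit system the zero \<open>y\<close> of the upper right entry, an apparent singularity of the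
  scalar equation for the first component, has gone to infinity. That equation has the
  singular points \<open>0, 1, a, \<infinity>\<close> only, and splitting off powers of \<open>t\<close>, \<open>t - a\<close>, \<open>t - 1\<close> makes it a
  Heun equation whose accessory parameter is \<open>l\<close> plus a function of \<open>a\<close>, \<open>e\<close> and the \<open>\<alpha>\<^sub>j\<close>
  (\<open>limit_system_bij_heun\<close>).
\<close>

section \<open>The limit system and the Heun equation\<close>

definition cubic :: "complex \<Rightarrow> complex \<Rightarrow> complex" where
  "cubic a t = t * (t - 1) * (t - a)"

text \<open>
  Added to \<open>e\<^sup>2 t\<^sup>4\<close>, this polynomial takes the value \<open>\<alpha>\<^sub>j\<^sup>2 T'(t\<^sub>j)\<^sup>2\<close> at each node
  \<open>t\<^sub>1 = 0\<close>, \<open>t\<^sub>2 = a\<close>, \<open>t\<^sub>3 = 1\<close> of \<open>T = cubic a\<close>. So the residues of the matrix below have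
  eigenvalues \<open>\<plusminus>\<alpha>\<^sub>j\<close>. For given \<open>e\<close> this leaves open a multiple \<open>l T\<close>; its coefficient \<open>l\<close> carries
  the accessory parameter.
\<close>
definition limit_numerator ::
  "complex \<Rightarrow> complex \<Rightarrow> complex \<Rightarrow> complex \<Rightarrow> complex \<Rightarrow> complex \<Rightarrow> complex \<Rightarrow> complex" where
  "limit_numerator \<alpha>1 \<alpha>2 \<alpha>3 a e l t =
     \<alpha>1^2 * a * ((t - 1) * (t - a)) + \<alpha>2^2 * (a * (a - 1)) * (t * (t - 1))
     + \<alpha>3^2 * (1 - a) * (t * (t - a))
     + l * cubic a t + e^2 * (cubic a t * (t + 1 + a) - t^4)"

definition limit_matrix ::
  "complex \<Rightarrow> complex \<Rightarrow> complex \<Rightarrow> complex \<Rightarrow> complex \<Rightarrow> complex \<Rightarrow> complex \<Rightarrow> complex^2^2" where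
  "limit_matrix \<alpha>1 \<alpha>2 \<alpha>3 a e l t =
     vector [vector [e * t^2 / cubic a t, 1 / cubic a t],
             vector [limit_numerator \<alpha>1 \<alpha>2 \<alpha>3 a e l t / cubic a t, - (e * t^2 / cubic a t)]]"

text \<open>
  The number \<open>q\<close> in the numerator \<open>\<alpha> \<beta> t - q\<close> of the equation that is left when the powers
  \<open>(t - t\<^sub>j)\<^bsup>\<alpha>\<^sub>j\<^esup>\<close> are split off from the first component of a solution.
\<close>
definition accessory ::
  "complex \<Rightarrow> complex \<Rightarrow> complex \<Rightarrow> complex \<Rightarrow> complex \<Rightarrow> complex \<Rightarrow> complex" where
  "accessory \<alpha>1 \<alpha>2 \<alpha>3 a e l =
     \<alpha>1^2 * (1 + a) + \<alpha>2^2 * (1 - a) + \<alpha>3^2 * (a - 1)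
     + (2 * \<alpha>1 * \<alpha>2 + \<alpha>1 + \<alpha>2) + (2 * \<alpha>1 * \<alpha>3 + \<alpha>1 + \<alpha>3) * a
     + e^2 * (1 + a) + l"

lemma log_branch_DERIV:
  assumes "open D" "log_branch D c l" "t \<in> D"
  shows "(l has_field_derivative 1 / (t - c)) (at t)"
proof -
  have hol: "l holomorphic_on D" and el: "\<And>w. w \<in> D \<Longrightarrow> exp (l w) = w - c"
    using assms(2) by (auto simp: log_branch_def)
  have d: "(l has_field_derivative deriv l t) (at t)"
    using hol assms holomorphic_derivI by blast
  have "((\<lambda>w. exp (l w)) has_field_derivative exp (l t) * deriv l t) (at t)"
    using d by (auto intro!: derivative_eq_intros)
  moreover have "((\<lambda>w. exp (l w)) has_field_derivative 1) (at t)"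
    by (rule has_field_derivative_transform_within_open[of "\<lambda>w. w - c" _ _ D])
       (use assms el in \<open>auto intro!: derivative_eq_intros\<close>)
  ultimately have "(t - c) * deriv l t = 1"
    using DERIV_unique el assms(3) by fastforce
  then have "deriv l t = 1 / (t - c)"
    by (metis mult_zero_left nonzero_eq_divide_eq mult.commute zero_neq_one)
  then show ?thesis using d by simp
qed

lemma heun_solutionsI:
  assumes "open D" "u \<in> extensional D"
    and 1: "\<And>t. t \<in> D \<Longrightarrow> (u has_field_derivative u1 t) (at t)"
    and 2: "\<And>t. t \<in> D \<Longrightarrow> (u1 has_field_derivative
        - ((\<gamma> / t + \<eta> / (t - 1) + \<epsilon> / (t - a)) * u1 t
           + (\<alpha> * \<beta> * t - q) / (t * (t - 1) * (t - a)) * u t)) (at t)"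
  shows "u \<in> heun_solutions a \<gamma> \<eta> \<epsilon> \<alpha> \<beta> q D"
proof -
  have "deriv u t = u1 t" if "t \<in> D" for t using 1[OF that] by (rule DERIV_imp_deriv)
  moreover have "deriv (deriv u) t = - ((\<gamma> / t + \<eta> / (t - 1) + \<epsilon> / (t - a)) * u1 t
           + (\<alpha> * \<beta> * t - q) / (t * (t - 1) * (t - a)) * u t)" if "t \<in> D" for t
    by (rule DERIV_imp_deriv, rule has_field_derivative_transform_within_open[OF 2[OF that] assms(1) that])
       (use calculation in auto)
  moreover have "u holomorphic_on D"
    using 1 assms(1) holomorphic_on_open by blast
  ultimately show ?thesis using assms(2) by (simp add: heun_solutions_def)
qed

lemma heun_solutionsD:
  assumes "open D" "u \<in> heun_solutions a \<gamma> \<eta> \<epsilon> \<alpha> \<beta> q D" "t \<in> D"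
  shows "(u has_field_derivative deriv u t) (at t)"
    and "(deriv u has_field_derivative
        - ((\<gamma> / t + \<eta> / (t - 1) + \<epsilon> / (t - a)) * deriv u t
           + (\<alpha> * \<beta> * t - q) / (t * (t - 1) * (t - a)) * u t)) (at t)"
proof -
  have hol: "u holomorphic_on D" and
    eq: "deriv (deriv u) t + ((\<gamma> / t + \<eta> / (t - 1) + \<epsilon> / (t - a)) * deriv u t
           + (\<alpha> * \<beta> * t - q) / (t * (t - 1) * (t - a)) * u t) = 0"
    using assms by (auto simp: heun_solutions_def add.assoc)
  show "(u has_field_derivative deriv u t) (at t)"
    using hol assms holomorphic_derivI by blast
  have "deriv u holomorphic_on D" using hol assms(1) by (simp add: holomorphic_deriv)
  then have "(deriv u has_field_derivative deriv (deriv u) t) (at t)"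
    using assms holomorphic_derivI by blast
  moreover have "deriv (deriv u) t = - ((\<gamma> / t + \<eta> / (t - 1) + \<epsilon> / (t - a)) * deriv u t
           + (\<alpha> * \<beta> * t - q) / (t * (t - 1) * (t - a)) * u t)"
    using eq by (rule eq_neg_iff_add_eq_0[THEN iffD2])
  ultimately show "(deriv u has_field_derivative
        - ((\<gamma> / t + \<eta> / (t - 1) + \<epsilon> / (t - a)) * deriv u t
           + (\<alpha> * \<beta> * t - q) / (t * (t - 1) * (t - a)) * u t)) (at t)" by simp
qed

lemma cubic_DERIV: "(cubic a has_field_derivative
    (t - 1) * (t - a) + t * (t - a) + t * (t - 1)) (at t)"
proof -
  have "((\<lambda>t. t * (t - 1) * (t - a)) has_field_derivative
    (t - 1) * (t - a) + t * (t - a) + t * (t - 1)) (at t)"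
    by (auto intro!: derivative_eq_intros simp: algebra_simps)
  then show ?thesis by (simp add: cubic_def[abs_def])
qed

lemma first_order_coefficient:
  assumes "t \<noteq> 0" "t \<noteq> 1" "t \<noteq> (a::complex)"
  shows "(t - 1) * (t - a) + t * (t - a) + t * (t - 1) =
    cubic a t * (((1 + 2 * \<alpha>1) / t + (1 + 2 * \<alpha>3) / (t - 1) + (1 + 2 * \<alpha>2) / (t - a))
      + 2 * (- \<alpha>1 / t - \<alpha>2 / (t - a) - \<alpha>3 / (t - 1)))"
proof -
  have *: "((1 + 2 * \<alpha>1) / t + (1 + 2 * \<alpha>3) / (t - 1) + (1 + 2 * \<alpha>2) / (t - a))
      + 2 * (- \<alpha>1 / t - \<alpha>2 / (t - a) - \<alpha>3 / (t - 1)) = 1 / t + 1 / (t - 1) + 1 / (t - a)"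
    by (simp add: add_divide_distrib algebra_simps)
  show ?thesis unfolding * cubic_def using assms by (simp add: divide_simps) (simp add: algebra_simps)
qed

text \<open>
  For \<open>u = \<omega> \<phi>\<close> with \<open>\<omega>' = P \<omega>\<close> the Heun operator \<open>u'' + H u' + V u\<close> becomes \<open>\<omega>\<close> times
  \<open>\<phi>'' + (2 P + H) \<phi>' + (P' + P\<^sup>2 + P H + V) \<phi>\<close>. The identity below and the previous one identify
  these coefficients with those of the scalar equation for the first component of a solution of
  the system. At \<open>t\<^sub>j\<close> the bracket has a double pole with coefficient \<open>- \<alpha>\<^sub>j\<^sup>2\<close>, as it must for the
  exponents \<open>\<plusminus>\<alpha>\<^sub>j\<close>, and \<open>(s + 1)\<^sup>2 - (e + 1)\<^sup>2\<close>, the coefficient of \<open>t\<close> in the numerator of \<open>V\<close>,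
  is the product of \<open>s - e\<close> and \<open>s + e + 2\<close>.
\<close>
lemma zeroth_order_coefficient:
  fixes t a \<alpha>1 \<alpha>2 \<alpha>3 e l :: complex
  defines "s \<equiv> \<alpha>1 + \<alpha>2 + \<alpha>3"
  defines "P \<equiv> - \<alpha>1 / t - \<alpha>2 / (t - a) - \<alpha>3 / (t - 1)"
  assumes "t \<noteq> 0" "t \<noteq> 1" "t \<noteq> a"
  shows "(cubic a t)^2 * ((\<alpha>1 / t^2 + \<alpha>2 / (t - a)^2 + \<alpha>3 / (t - 1)^2) + P^2
      + P * ((1 + 2 * \<alpha>1) / t + (1 + 2 * \<alpha>3) / (t - 1) + (1 + 2 * \<alpha>2) / (t - a))
      + ((s - e) * (s + e + 2) * t - accessory \<alpha>1 \<alpha>2 \<alpha>3 a e l) / (t * (t - 1) * (t - a)))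
    = - (cubic a t * (2 * e * t) + limit_numerator \<alpha>1 \<alpha>2 \<alpha>3 a e l t + (e * t^2)^2)"
proof -
  \<comment> \<open>With names for the three reciprocals the claim is a consequence of polynomial relations.\<close>
  define i j k where "i = 1 / t" and "j = 1 / (t - 1)" and "k = 1 / (t - a)"
  have rel: "t * i = 1" "(t - 1) * j = 1" "(t - a) * k = 1"
    using assms by (auto simp: i_def j_def k_def)
  have P: "P = - \<alpha>1 * i - \<alpha>2 * k - \<alpha>3 * j"
    by (simp add: P_def i_def j_def k_def)
  have "(cubic a t)^2 * ((\<alpha>1 * i^2 + \<alpha>2 * k^2 + \<alpha>3 * j^2) + P^2
      + P * ((1 + 2 * \<alpha>1) * i + (1 + 2 * \<alpha>3) * j + (1 + 2 * \<alpha>2) * k)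
      + ((s - e) * (s + e + 2) * t - accessory \<alpha>1 \<alpha>2 \<alpha>3 a e l) * (i * j * k))
    = - (cubic a t * (2 * e * t) + limit_numerator \<alpha>1 \<alpha>2 \<alpha>3 a e l t + (e * t^2)^2)"
    unfolding P cubic_def accessory_def limit_numerator_def s_def
    using rel by algebra
  then show ?thesis by (simp add: i_def j_def k_def power_divide)
qed

lemma weight_DERIV:
  assumes "open D" "log_branch D 0 l0" "log_branch D a la" "log_branch D 1 l1" "t \<in> D"
  shows "((\<lambda>t. exp (p1 * l0 t) * exp (p2 * la t) * exp (p3 * l1 t)) has_field_derivative
     (exp (p1 * l0 t) * exp (p2 * la t) * exp (p3 * l1 t))
       * (p1 / t + p2 / (t - a) + p3 / (t - 1))) (at t)"
proof -
  note [derivative_intros] =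
    log_branch_DERIV[OF assms(1,2,5)] log_branch_DERIV[OF assms(1,3,5)] log_branch_DERIV[OF assms(1,4,5)]
  show ?thesis
    by (rule derivative_eq_intros refl)+ (simp add: algebra_simps add_divide_distrib)
qed

lemma limit_system_solutions_iff:
  "\<Phi> \<in> system_solutions (limit_matrix \<alpha>1 \<alpha>2 \<alpha>3 a e l) D \<longleftrightarrow>
     \<Phi> \<in> extensional D \<and>
     (\<forall>t\<in>D. ((\<lambda>w. \<Phi> w $ 1) has_field_derivative
               (e * t^2 * \<Phi> t $ 1 + \<Phi> t $ 2) / cubic a t) (at t) \<and>
            ((\<lambda>w. \<Phi> w $ 2) has_field_derivative
               (limit_numerator \<alpha>1 \<alpha>2 \<alpha>3 a e l t * \<Phi> t $ 1 - e * t^2 * \<Phi> t $ 2) / cubic a t) (at t))"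
  by (simp add: system_solutions_def forall_2 limit_matrix_def matrix_vector_mult_def sum_2
      add_divide_distrib diff_divide_distrib)

text \<open>
  Since the upper right entry of the system is \<open>1 / T\<close>, the first component determines the
  second one, \<open>\<Phi>\<^sub>2 = T \<Phi>\<^sub>1' - e t\<^sup>2 \<Phi>\<^sub>1\<close>, and satisfies
  \<open>T \<Phi>\<^sub>1'' + T' \<Phi>\<^sub>1' = (2 e t + (B + e\<^sup>2 t\<^sup>4) / T) \<Phi>\<^sub>1\<close>. This equation has no singular point
  besides \<open>0, 1, a, \<infinity>\<close>, so multiplication by a product of powers, which moves one exponent
  at each finite singular point to 0, gives the Heun equation.
\<close>
lemma limit_system_bij_heun:
  fixes \<alpha>1 \<alpha>2 \<alpha>3 a e l :: complex
  defines "s \<equiv> \<alpha>1 + \<alpha>2 + \<alpha>3"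
  assumes D: "open D" "D \<inter> {0, 1, a} = {}"
    and br: "log_branch D 0 l0" "log_branch D a la" "log_branch D 1 l1"
  shows "bij_betw
     (\<lambda>\<Phi>. \<lambda>t\<in>D. exp (- \<alpha>1 * l0 t) * exp (- \<alpha>2 * la t) * exp (- \<alpha>3 * l1 t) * \<Phi> t $ 1)
     (system_solutions (limit_matrix \<alpha>1 \<alpha>2 \<alpha>3 a e l) D)
     (heun_solutions a (1 + 2 * \<alpha>1) (1 + 2 * \<alpha>3) (1 + 2 * \<alpha>2) (s - e) (s + e + 2)
        (accessory \<alpha>1 \<alpha>2 \<alpha>3 a e l) D)"
    (is "bij_betw ?F ?X ?Y")
proof -
  define \<omega> where "\<omega> t = exp (- \<alpha>1 * l0 t) * exp (- \<alpha>2 * la t) * exp (- \<alpha>3 * l1 t)" for t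
  define P where "P t = - \<alpha>1 / t - \<alpha>2 / (t - a) - \<alpha>3 / (t - 1)" for t
  define P' where "P' t = \<alpha>1 / t^2 + \<alpha>2 / (t - a)^2 + \<alpha>3 / (t - 1)^2" for t
  define H where "H t = (1 + 2 * \<alpha>1) / t + (1 + 2 * \<alpha>3) / (t - 1) + (1 + 2 * \<alpha>2) / (t - a)" for t
  define V where "V t = ((s - e) * (s + e + 2) * t - accessory \<alpha>1 \<alpha>2 \<alpha>3 a e l)
      / (t * (t - 1) * (t - a))" for t
  define T where "T = cubic a"
  define T' where "T' t = (t - 1) * (t - a) + t * (t - a) + t * (t - 1)" for t
  define B where "B = limit_numerator \<alpha>1 \<alpha>2 \<alpha>3 a e l"
  have \<omega>0: "\<omega> t \<noteq> 0" for t by (simp add: \<omega>_def)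
  have nz: "t \<noteq> 0" "t \<noteq> 1" "t \<noteq> a" if "t \<in> D" for t using that D(2) by auto
  have T0: "T t \<noteq> 0" if "t \<in> D" for t using nz[OF that] by (simp add: T_def cubic_def)
  have \<omega>D: "(\<omega> has_field_derivative \<omega> t * P t) (at t)" if "t \<in> D" for t
    using weight_DERIV[OF D(1) br that, of "- \<alpha>1" "- \<alpha>2" "- \<alpha>3"]
    by (simp add: \<omega>_def[abs_def] P_def)
  have PD: "(P has_field_derivative P' t) (at t)" if "t \<in> D" for t
    unfolding P_def[abs_def] P'_def using nz[OF that]
    by (auto intro!: derivative_eq_intros simp: power2_eq_square)
  have TD: "(T has_field_derivative T' t) (at t)" for t
    unfolding T_def T'_def by (rule cubic_DERIV)
  have id1: "T' t = T t * (H t + 2 * P t)" if "t \<in> D" for t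
    using first_order_coefficient[OF nz[OF that]] by (simp add: T_def T'_def H_def P_def)
  have id2: "(T t)^2 * (P' t + (P t)^2 + P t * H t + V t)
      = - (T t * (2 * e * t) + B t + (e * t^2)^2)" if "t \<in> D" for t
    using zeroth_order_coefficient[OF nz[OF that]]
    by (simp add: T_def P_def P'_def H_def V_def B_def s_def)
  define F where "F \<Phi> = (\<lambda>t\<in>D. \<omega> t * \<Phi> t $ 1)" for \<Phi> :: "complex \<Rightarrow> complex^2"
  define \<phi> where "\<phi> u t = u t / \<omega> t" for u t
  define \<psi> where "\<psi> u t = T t * (deriv u t - P t * u t) / \<omega> t - e * t^2 * \<phi> u t" for u t
  define G where "G u = (\<lambda>t\<in>D. vector [\<phi> u t, \<psi> u t] :: complex^2)" for u
  have X_D: "((\<lambda>w. \<Phi> w $ 1) has_field_derivative (e * t^2 * \<Phi> t $ 1 + \<Phi> t $ 2) / T t) (at t)"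
    "((\<lambda>w. \<Phi> w $ 2) has_field_derivative (B t * \<Phi> t $ 1 - e * t^2 * \<Phi> t $ 2) / T t) (at t)"
    if "\<Phi> \<in> ?X" "t \<in> D" for \<Phi> :: "complex \<Rightarrow> complex^2" and t
    using that unfolding limit_system_solutions_iff T_def B_def by blast+
  have Y_D: "(u has_field_derivative deriv u t) (at t)"
    "(deriv u has_field_derivative - (H t * deriv u t + V t * u t)) (at t)"
    if "u \<in> ?Y" "t \<in> D" for u t
    using heun_solutionsD[OF D(1) that] by (simp_all add: H_def V_def)
  have restr: "(restrict f D has_field_derivative d) (at t)"
    if "(f has_field_derivative d) (at t)" "t \<in> D" for f d and t :: complex
    by (rule has_field_derivative_transform_within_open[OF that(1) D(1) that(2)]) simp
  have FD: "(F \<Phi> has_field_derivative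
      \<omega> t * (P t * \<Phi> t $ 1 + (e * t^2 * \<Phi> t $ 1 + \<Phi> t $ 2) / T t)) (at t)"
    if "\<Phi> \<in> ?X" "t \<in> D" for \<Phi> :: "complex \<Rightarrow> complex^2" and t
  proof -
    have "((\<lambda>t. \<omega> t * \<Phi> t $ 1) has_field_derivative
      \<omega> t * (P t * \<Phi> t $ 1 + (e * t^2 * \<Phi> t $ 1 + \<Phi> t $ 2) / T t)) (at t)"
      by (rule derivative_eq_intros \<omega>D X_D that refl)+ (simp add: algebra_simps)
    then show ?thesis unfolding F_def using that(2) by (rule restr)
  qed
  have F_in: "F \<Phi> \<in> ?Y" if X: "\<Phi> \<in> ?X" for \<Phi> :: "complex \<Rightarrow> complex^2"
  proof (rule heun_solutionsI[OF D(1)])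
    show "F \<Phi> \<in> extensional D" by (simp add: F_def)
    fix t assume t: "t \<in> D"
    show "(F \<Phi> has_field_derivative
      \<omega> t * (P t * \<Phi> t $ 1 + (e * t^2 * \<Phi> t $ 1 + \<Phi> t $ 2) / T t)) (at t)"
      by (rule FD[OF X t])
    define f g where "f = \<Phi> t $ 1" and "g = \<Phi> t $ 2"
    have dd: "((\<lambda>t. \<omega> t * (P t * \<Phi> t $ 1 + (e * t^2 * \<Phi> t $ 1 + \<Phi> t $ 2) / T t))
      has_field_derivative
        \<omega> t * P t * (P t * f + (e * t^2 * f + g) / T t) +
        \<omega> t * (P' t * f + P t * ((e * t^2 * f + g) / T t)
          + ((2 * e * t * f + e * t^2 * ((e * t^2 * f + g) / T t)
               + (B t * f - e * t^2 * g) / T t) * T t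
              - (e * t^2 * f + g) * T' t) / (T t * T t))) (at t)"
      unfolding f_def g_def
      apply (rule derivative_eq_intros \<omega>D X_D PD TD that t refl T0)+
      apply (simp add: algebra_simps)
      done
    define i where "i = 1 / T t"
    have i: "T t * i = 1" using T0[OF t] by (simp add: i_def)
    have "P t * (P t * f + (e * t^2 * f + g) * i) +
         (P' t * f + P t * ((e * t^2 * f + g) * i)
          + ((2 * e * t * f + e * t^2 * ((e * t^2 * f + g) * i)
               + (B t * f - e * t^2 * g) * i) * T t
              - (e * t^2 * f + g) * T' t) * (i * i))
        + (H t * (P t * f + (e * t^2 * f + g) * i) + V t * f) = 0"
      using id1[OF t] id2[OF t] i by algebra
    then have "\<omega> t * (P t * (P t * f + (e * t^2 * f + g) * i) +
         (P' t * f + P t * ((e * t^2 * f + g) * i)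
          + ((2 * e * t * f + e * t^2 * ((e * t^2 * f + g) * i)
               + (B t * f - e * t^2 * g) * i) * T t
              - (e * t^2 * f + g) * T' t) * (i * i))
        + (H t * (P t * f + (e * t^2 * f + g) * i) + V t * f)) = 0"
      by simp
    then have "\<omega> t * P t * (P t * f + (e * t^2 * f + g) * i) +
        \<omega> t * (P' t * f + P t * ((e * t^2 * f + g) * i)
          + ((2 * e * t * f + e * t^2 * ((e * t^2 * f + g) * i)
               + (B t * f - e * t^2 * g) * i) * T t
              - (e * t^2 * f + g) * T' t) * (i * i))
       = - (H t * (\<omega> t * (P t * f + (e * t^2 * f + g) * i)) + V t * (\<omega> t * f))"
      by algebra
    then have "\<omega> t * P t * (P t * f + (e * t^2 * f + g) / T t) +
        \<omega> t * (P' t * f + P t * ((e * t^2 * f + g) / T t)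
          + ((2 * e * t * f + e * t^2 * ((e * t^2 * f + g) / T t)
               + (B t * f - e * t^2 * g) / T t) * T t
              - (e * t^2 * f + g) * T' t) / (T t * T t))
       = - (H t * (\<omega> t * (P t * f + (e * t^2 * f + g) / T t)) + V t * F \<Phi> t)"
      using t by (simp add: i_def F_def f_def)
    with dd show "((\<lambda>t. \<omega> t * (P t * \<Phi> t $ 1 + (e * t^2 * \<Phi> t $ 1 + \<Phi> t $ 2) / T t))
      has_field_derivative
        - (((1 + 2 * \<alpha>1) / t + (1 + 2 * \<alpha>3) / (t - 1) + (1 + 2 * \<alpha>2) / (t - a)) *
            (\<omega> t * (P t * \<Phi> t $ 1 + (e * t^2 * \<Phi> t $ 1 + \<Phi> t $ 2) / T t))
           + ((s - e) * (s + e + 2) * t - accessory \<alpha>1 \<alpha>2 \<alpha>3 a e l)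
               / (t * (t - 1) * (t - a)) * F \<Phi> t)) (at t)"
      by (simp add: H_def V_def f_def g_def)
  qed
  have G_in: "G u \<in> ?X" if Y: "u \<in> ?Y" for u
  proof -
    have "((\<lambda>w. G u w $ 1) has_field_derivative (e * t^2 * \<phi> u t + \<psi> u t) / T t) (at t)"
      "((\<lambda>w. G u w $ 2) has_field_derivative (B t * \<phi> u t - e * t^2 * \<psi> u t) / T t) (at t)"
      if t: "t \<in> D" for t
    proof -
      define i j where "i = 1 / T t" and "j = 1 / \<omega> t"
      have ij: "T t * i = 1" "\<omega> t * j = 1" using T0[OF t] \<omega>0[of t] by (simp_all add: i_def j_def)
      have "(\<phi> u has_field_derivative (deriv u t * \<omega> t - u t * (\<omega> t * P t)) / (\<omega> t * \<omega> t)) (at t)"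
        unfolding \<phi>_def[abs_def]
        by (rule derivative_eq_intros Y_D[OF Y t] \<omega>D[OF t] \<omega>0 refl)+
      moreover have "(deriv u t * \<omega> t - u t * (\<omega> t * P t)) * (j * j) = j * (deriv u t - P t * u t)"
        using ij by algebra
      then have "(deriv u t * \<omega> t - u t * (\<omega> t * P t)) / (\<omega> t * \<omega> t) = (deriv u t - P t * u t) / \<omega> t"
        by (simp add: j_def)
      ultimately have d\<phi>: "(\<phi> u has_field_derivative (deriv u t - P t * u t) / \<omega> t) (at t)" by simp
      have e1: "(e * t^2 * \<phi> u t + \<psi> u t) / T t = (deriv u t - P t * u t) / \<omega> t"
        using T0[OF t] by (simp add: \<psi>_def)
      have d\<psi>: "(\<psi> u has_field_derivative
          ((T' t * (deriv u t - P t * u t) + T t * (- (H t * deriv u t + V t * u t)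
             - (P' t * u t + P t * deriv u t))) * \<omega> t
            - T t * (deriv u t - P t * u t) * (\<omega> t * P t)) / (\<omega> t * \<omega> t)
          - (2 * e * t * \<phi> u t + e * t^2 * ((deriv u t - P t * u t) / \<omega> t))) (at t)"
        unfolding \<psi>_def[abs_def]
        apply (rule derivative_eq_intros Y_D[OF Y t] \<omega>D[OF t] d\<phi> PD[OF t] TD \<omega>0 refl)+
        apply (simp add: algebra_simps)
        done
      have "((T' t * (deriv u t - P t * u t) + T t * (- (H t * deriv u t + V t * u t)
             - (P' t * u t + P t * deriv u t))) * \<omega> t
            - T t * (deriv u t - P t * u t) * (\<omega> t * P t)) * (j * j)
          - (2 * e * t * (u t * j) + e * t^2 * ((deriv u t - P t * u t) * j))
          = (B t * (u t * j) - e * t^2 * (T t * (deriv u t - P t * u t) * j - e * t^2 * (u t * j))) * i"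
        using id1[OF t] id2[OF t] ij by algebra
      then have e2: "((T' t * (deriv u t - P t * u t) + T t * (- (H t * deriv u t + V t * u t)
             - (P' t * u t + P t * deriv u t))) * \<omega> t
            - T t * (deriv u t - P t * u t) * (\<omega> t * P t)) / (\<omega> t * \<omega> t)
          - (2 * e * t * \<phi> u t + e * t^2 * ((deriv u t - P t * u t) / \<omega> t))
          = (B t * \<phi> u t - e * t^2 * \<psi> u t) / T t"
        by (simp add: i_def j_def \<psi>_def \<phi>_def)
      show "((\<lambda>w. G u w $ 1) has_field_derivative (e * t^2 * \<phi> u t + \<psi> u t) / T t) (at t)"
        by (rule has_field_derivative_transform_within_open[OF d\<phi>[folded e1] D(1) t]) (simp add: G_def)
      show "((\<lambda>w. G u w $ 2) has_field_derivative (B t * \<phi> u t - e * t^2 * \<psi> u t) / T t) (at t)"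
        by (rule has_field_derivative_transform_within_open[OF d\<psi>[unfolded e2] D(1) t]) (simp add: G_def)
    qed
    then show ?thesis
      unfolding limit_system_solutions_iff T_def B_def by (simp add: G_def)
  qed
  have GF: "G (F \<Phi>) = \<Phi>" if X: "\<Phi> \<in> ?X" for \<Phi> :: "complex \<Rightarrow> complex^2"
  proof
    fix t
    show "G (F \<Phi>) t = \<Phi> t"
    proof (cases "t \<in> D")
      case False
      then show ?thesis using X by (simp add: G_def limit_system_solutions_iff extensional_def)
    next
      case t: True
      have 1: "\<phi> (F \<Phi>) t = \<Phi> t $ 1" using t \<omega>0 by (simp add: \<phi>_def F_def)
      have "deriv (F \<Phi>) t = \<omega> t * (P t * \<Phi> t $ 1 + (e * t^2 * \<Phi> t $ 1 + \<Phi> t $ 2) / T t)"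
        using FD[OF X t] by (rule DERIV_imp_deriv)
      then have "deriv (F \<Phi>) t - P t * F \<Phi> t = \<omega> t * ((e * t^2 * \<Phi> t $ 1 + \<Phi> t $ 2) / T t)"
        using t by (simp add: F_def algebra_simps)
      then have 2: "\<psi> (F \<Phi>) t = \<Phi> t $ 2"
        unfolding \<psi>_def 1 using T0[OF t] \<omega>0[of t] by simp
      show ?thesis using t by (simp add: G_def 1 2 vec_eq_iff forall_2)
    qed
  qed
  have FG: "F (G u) = u" if "u \<in> ?Y" for u
  proof
    fix t
    show "F (G u) t = u t"
      using that \<omega>0[of t] by (cases "t \<in> D") (auto simp: F_def G_def \<phi>_def heun_solutions_def extensional_def)
  qed
  have "bij_betw F ?X ?Y"
    by (rule bij_betw_byWitness[where f' = G]) (use F_in G_in GF FG in auto)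
  then show ?thesis by (simp add: F_def[abs_def] \<omega>_def)
qed

section \<open>Residues, gauge transformation and interpolation\<close>

text \<open>
  The numerator may vanish at \<open>c\<close>, and then there is no pole; the limit of \<open>(t - c) f t / T t\<close>
  gives the residue in both cases.
\<close>
lemma residue_over_cubic:
  assumes "f holomorphic_on UNIV" "cubic x c = 0" "(c - 1) * (c - x) + c * (c - x) + c * (c - 1) \<noteq> 0"
  shows "residue (\<lambda>t. f t / (t * (t - 1) * (t - x))) c
    = f c / ((c - 1) * (c - x) + c * (c - x) + c * (c - 1))"
proof (rule residue_simple')
  define S where "S = - ({0, 1, x} - {c})"
  have T: "t * (t - 1) * (t - x) = cubic x t" for t by (simp add: cubic_def)
  show "open S" unfolding S_def by (intro open_Compl finite_imp_closed) auto
  show "c \<in> S" by (simp add: S_def)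
  show "(\<lambda>t. f t / (t * (t - 1) * (t - x))) holomorphic_on S - {c}"
    using assms(1) by (auto simp: S_def intro!: holomorphic_intros intro: holomorphic_on_subset)
  have "((\<lambda>t. (cubic x t - cubic x c) / (t - c)) \<longlongrightarrow> (c - 1) * (c - x) + c * (c - x) + c * (c - 1)) (at c)"
    using cubic_DERIV by (simp add: has_field_derivative_iff)
  moreover have "isCont f c"
    using assms(1) by (meson UNIV_I continuous_on_eq_continuous_at holomorphic_on_imp_continuous_on open_UNIV)
  then have "(f \<longlongrightarrow> f c) (at c)" by (simp add: isCont_def)
  ultimately have "((\<lambda>t. f t / ((cubic x t - cubic x c) / (t - c)))
      \<longlongrightarrow> f c / ((c - 1) * (c - x) + c * (c - x) + c * (c - 1))) (at c)"
    using assms(3) by (intro tendsto_divide)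
  then show "((\<lambda>t. f t / (t * (t - 1) * (t - x)) * (t - c))
      \<longlongrightarrow> f c / ((c - 1) * (c - x) + c * (c - x) + c * (c - 1))) (at c)"
    by (simp add: T assms(2))
qed

lemma traceless_eigenvalues:
  fixes M :: "complex^2^2"
  assumes "eigenvalues M = {\<alpha>, - \<alpha>}" "M $ 2 $ 2 = - (M $ 1 $ 1)"
  shows "(M $ 1 $ 1)^2 + M $ 1 $ 2 * M $ 2 $ 1 = \<alpha>^2"
proof -
  have "\<alpha> \<in> eigenvalues M" using assms by simp
  then obtain v :: "complex^2" where v: "v \<noteq> 0" "M *v v = \<alpha> *s v"
    by (auto simp: eigenvalues_def)
  have 1: "M $ 1 $ 1 * v $ 1 + M $ 1 $ 2 * v $ 2 = \<alpha> * v $ 1"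
    and 2: "M $ 2 $ 1 * v $ 1 - M $ 1 $ 1 * v $ 2 = \<alpha> * v $ 2"
    using v(2) assms(2) by (auto simp: vec_eq_iff forall_2 matrix_vector_mult_def sum_2)
  have "((M $ 1 $ 1)^2 + M $ 1 $ 2 * M $ 2 $ 1 - \<alpha>^2) * v $ 1 = 0" using 1 2 by algebra
  moreover have "((M $ 1 $ 1)^2 + M $ 1 $ 2 * M $ 2 $ 1 - \<alpha>^2) * v $ 2 = 0" using 1 2 by algebra
  moreover have "v $ 1 \<noteq> 0 \<or> v $ 2 \<noteq> 0" using v(1) by (auto simp: vec_eq_iff forall_2)
  ultimately show ?thesis by auto
qed

text \<open>
  What the prescribed eigenvalues say about the numerators: a traceless 2 by 2 matrix with
  eigenvalue \<open>\<alpha>\<close> has determinant \<open>- \<alpha>\<^sup>2\<close>.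
\<close>
lemma A_matrix_residue_determinant:
  assumes "eigenvalues (residue_matrix (A_matrix \<delta> y \<kappa> p N x) c) = {\<alpha>, - \<alpha>}"
    and "cubic x c = 0"
  defines "T' \<equiv> (c - 1) * (c - x) + c * (c - x) + c * (c - 1)"
  assumes "T' \<noteq> 0"
  shows "(- \<delta> * (c - y x)^2 + p x * (c - y x) + z_of y x)^2
     + \<kappa> x * (c - y x) * poly (N x) c = \<alpha>^2 * T'^2"
proof -
  define d where "d t = - \<delta> * (t - y x)^2 + p x * (t - y x) + z_of y x" for t
  define R where "R = residue_matrix (A_matrix \<delta> y \<kappa> p N x) c"
  have *: "residue (\<lambda>t. f t / (t * (t - 1) * (t - x))) c = f c / T'"
    if "f holomorphic_on UNIV" for f
    using residue_over_cubic[OF that assms(2)] assms(4) by (simp add: T'_def)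
  have hol: "d holomorphic_on UNIV" "(\<lambda>t. \<kappa> x * (t - y x)) holomorphic_on UNIV"
    "poly (N x) holomorphic_on UNIV" "(\<lambda>t. - d t) holomorphic_on UNIV"
    by (auto simp: d_def[abs_def] intro!: holomorphic_intros)
  have entries: "R $ 1 $ 1 = residue (\<lambda>t. d t / (t * (t - 1) * (t - x))) c"
    "R $ 1 $ 2 = residue (\<lambda>t. \<kappa> x * (t - y x) / (t * (t - 1) * (t - x))) c"
    "R $ 2 $ 1 = residue (\<lambda>t. poly (N x) t / (t * (t - 1) * (t - x))) c"
    "R $ 2 $ 2 = residue (\<lambda>t. - (d t / (t * (t - 1) * (t - x)))) c"
    by (simp_all add: R_def residue_matrix_def A_matrix_def Let_def d_def)
  have "R $ 1 $ 1 = d c / T'" "R $ 1 $ 2 = \<kappa> x * (c - y x) / T'" "R $ 2 $ 1 = poly (N x) c / T'"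
    "R $ 2 $ 2 = - d c / T'"
    unfolding entries minus_divide_left by (rule hol[THEN *])+
  then have "(d c / T')^2 + (\<kappa> x * (c - y x) / T') * (poly (N x) c / T') = \<alpha>^2"
    using traceless_eigenvalues[of R \<alpha>] assms(1) by (simp add: R_def)
  then have "(d c)^2 + \<kappa> x * (c - y x) * poly (N x) c = \<alpha>^2 * T'^2"
    using assms(4) by (simp add: power_divide divide_simps power2_eq_square)
  then show ?thesis by (simp add: d_def)
qed

lemma matrix_inv_eqI:
  fixes A B :: "'a::semiring_1^'n^'n"
  assumes "A ** B = mat 1" "B ** A = mat 1"
  shows "matrix_inv A = B"
proof -
  have "A ** matrix_inv A = mat 1 \<and> matrix_inv A ** A = mat 1"
    unfolding matrix_inv_def by (rule someI[of _ B]) (use assms in simp)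
  then show ?thesis
    by (metis assms(2) matrix_mul_assoc matrix_mul_lid matrix_mul_rid)
qed

lemma gauge_transform_lower_triangular:
  fixes r f0 f1 :: complex
  assumes "r \<noteq> 0"
  defines "P \<equiv> vector [vector [[:r:], 0], vector [[:f0, f1:], [:1 / r:]]] :: (complex poly)^2^2"
  shows "det (gauge_matrix 0 s P t) = 1"
    and "gauge_transform (gauge_matrix 0 s P) (\<lambda>t. vector [vector [d t, b t], vector [c t, - d t]]) t
      = vector [vector [d t - r * (f0 + f1 * t) * b t, r^2 * b t],
          vector [2 * ((f0 + f1 * t) / r) * d t + c t / r^2 - (f0 + f1 * t)^2 * b t + f1 / r,
            - (d t - r * (f0 + f1 * t) * b t)]]"
proof -
  have R: "gauge_matrix 0 s P = (\<lambda>t. vector [vector [r, 0], vector [f0 + f1 * t, 1 / r]])"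
    by (rule ext) (simp add: gauge_matrix_def P_def vec_eq_iff forall_2 algebra_simps)
  show "det (gauge_matrix 0 s P t) = 1" using assms(1) by (simp add: R det_2)
  have inv: "matrix_inv (vector [vector [r, 0], vector [f0 + f1 * t, 1 / r]])
      = (vector [vector [1 / r, 0], vector [- (f0 + f1 * t), r]] :: complex^2^2)"
    by (rule matrix_inv_eqI)
       (use assms(1) in \<open>simp_all add: vec_eq_iff forall_2 matrix_matrix_mult_def sum_2 mat_def field_simps\<close>)
  have der: "(\<chi> i j. deriv (\<lambda>w. (vector [vector [r, 0], vector [f0 + f1 * w, 1 / r]] :: complex^2^2) $ i $ j) t)
      = (vector [vector [0, 0], vector [f1, 0]] :: complex^2^2)"
    by (auto simp: vec_eq_iff forall_2 intro!: DERIV_imp_deriv derivative_eq_intros)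
  show "gauge_transform (gauge_matrix 0 s P) (\<lambda>t. vector [vector [d t, b t], vector [c t, - d t]]) t
      = vector [vector [d t - r * (f0 + f1 * t) * b t, r^2 * b t],
          vector [2 * ((f0 + f1 * t) / r) * d t + c t / r^2 - (f0 + f1 * t)^2 * b t + f1 / r,
            - (d t - r * (f0 + f1 * t) * b t)]]"
    unfolding gauge_transform_def R inv der using assms(1)
    by (simp add: vec_eq_iff forall_2 matrix_matrix_mult_def sum_2 field_simps power2_eq_square)
qed

text \<open>
  Lagrange interpolation at the three singular points: a cubic is determined by its leading
  coefficient and its values there.
\<close>
lemma cubic_interpolation:
  fixes x k u v w :: complex
  assumes "x \<noteq> 0" "x \<noteq> 1"
  defines "q \<equiv> \<lambda>t. k + u * t + v * t^2 + w * t^3"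
  shows "q t = w * cubic x t + q 0 * (t - 1) * (t - x) / x + q 1 * t * (t - x) / (1 - x)
     + q x * t * (t - 1) / (x * (x - 1))"
proof -
  have "x * (x - 1) * q t = x * (x - 1) * (w * cubic x t) + q 0 * (t - 1) * (t - x) * (x - 1)
     - q 1 * t * (t - x) * x + q x * t * (t - 1)"
    unfolding q_def cubic_def by (simp add: algebra_simps power2_eq_square power3_eq_cube)
  then have "q t = (x * (x - 1) * (w * cubic x t) + q 0 * (t - 1) * (t - x) * (x - 1)
     - q 1 * t * (t - x) * x + q x * t * (t - 1)) / (x * (x - 1))"
    using assms by (simp add: eq_divide_eq mult.commute)
  also have "\<dots> = w * cubic x t + q 0 * (t - 1) * (t - x) / x - q 1 * t * (t - x) / (x - 1)
     + q x * t * (t - 1) / (x * (x - 1))"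
    using assms by (simp add: add_divide_distrib diff_divide_distrib)
  also have "q 1 * t * (t - x) / (x - 1) = - (q 1 * t * (t - x) / (1 - x))"
    by (metis minus_diff_eq minus_divide_right)
  finally show ?thesis by simp
qed

text \<open>
  With \<open>E = \<zeta> t\<^sup>2\<close>, which agrees with \<open>d\<close> at \<open>t = y\<close>, the quotient of \<open>d - E\<close> by \<open>t - y\<close> is
  \<open>g = g0 + g1 t\<close>, and \<open>B\<close> is the numerator of the lower left entry after the gauge
  transformation. The identity \<open>(1 - t / y) B = d\<^sup>2 - E\<^sup>2 + k (t - y) N + (t - y) g1 T\<close> gives
  the values of \<open>B\<close> at the nodes, and these no longer contain \<open>p\<close>, \<open>k\<close> and \<open>N\<close>. Together with
  the leading coefficient they express \<open>B\<close> by quantities that converge at the pole.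
\<close>
lemma gauged_numerator_interpolation:
  fixes x y \<zeta> \<delta> p k n0 n1 :: complex
  defines "d \<equiv> \<lambda>t. - \<delta> * (t - y)^2 + p * (t - y) + \<zeta> * y^2"
    and "g0 \<equiv> \<delta> * y + p - \<zeta> * y" and "g1 \<equiv> - \<delta> - \<zeta>"
  defines "B \<equiv> \<lambda>t. - y * (2 * (g0 + g1 * t) * d t + k * (n0 + n1 * t)
      - (g0 + g1 * t)^2 * (t - y) + g1 * cubic x t)"
  assumes x: "x \<noteq> 0" "x \<noteq> 1" and y: "y \<noteq> 0" "y \<noteq> 1" "y \<noteq> x"
    and nodes: "(d 0)^2 + k * (0 - y) * n0 = \<alpha>1^2 * x^2"
      "(d 1)^2 + k * (1 - y) * (n0 + n1) = \<alpha>3^2 * (1 - x)^2"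
      "(d x)^2 + k * (x - y) * (n0 + n1 * x) = \<alpha>2^2 * (x * (x - 1))^2"
  shows "B t = y * (\<zeta> + \<delta>) * (\<zeta> + 1 - \<delta>) * cubic x t
     + \<alpha>1^2 * x^2 * (t - 1) * (t - x) / x
     + (\<alpha>3^2 * (1 - x)^2 - \<zeta>^2) / (1 - 1 / y) * t * (t - x) / (1 - x)
     + (\<alpha>2^2 * (x * (x - 1))^2 - (\<zeta> * x^2)^2) / (1 - x / y) * t * (t - 1) / (x * (x - 1))"
proof -
  define d0 d1 where "d0 = \<zeta> * y^2 - \<delta> * y^2 - p * y" and "d1 = 2 * \<delta> * y + p"
  define C0 C1 C2 C3 where "C0 = - y * (2 * g0 * d0 + k * n0 + g0^2 * y)"
    and "C1 = - y * (2 * g0 * d1 + 2 * g1 * d0 + k * n1 + 2 * g0 * g1 * y - g0^2 + g1 * x)"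
    and "C2 = - y * (2 * g1 * d1 - 2 * \<delta> * g0 - 2 * g0 * g1 + g1^2 * y - g1 * (1 + x))"
    and "C3 = y * (\<zeta> + \<delta>) * (\<zeta> + 1 - \<delta>)"
  have coeffs: "B u = C0 + C1 * u + C2 * u^2 + C3 * u^3" for u
    unfolding B_def d_def d0_def d1_def g1_def cubic_def C0_def C1_def C2_def C3_def
    by (simp add: algebra_simps power2_eq_square power3_eq_cube)
  have B: "B t = C3 * cubic x t + B 0 * (t - 1) * (t - x) / x + B 1 * t * (t - x) / (1 - x)
     + B x * t * (t - 1) / (x * (x - 1))"
    using cubic_interpolation[OF x, of C0 C1 t C2 C3] by (simp only: coeffs[symmetric])
  have prod: "(1 - u / y) * B u = (d u)^2 + k * (u - y) * (n0 + n1 * u) - (\<zeta> * u^2)^2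
      + (u - y) * g1 * cubic x u" for u
  proof -
    have dE: "d u - \<zeta> * u^2 = (g0 + g1 * u) * (u - y)"
      unfolding d_def g0_def g1_def by algebra
    have "(1 - u / y) * y = y - u" using y by (simp add: algebra_simps)
    then show ?thesis using dE unfolding B_def by algebra
  qed
  have cubic0: "cubic x 0 = 0" "cubic x 1 = 0" "cubic x x = 0" by (simp_all add: cubic_def)
  have nz: "1 - 1 / y \<noteq> 0" "1 - x / y \<noteq> 0" using y by auto
  have "B 0 = \<alpha>1^2 * x^2" using prod[of 0] nodes(1) by (simp add: cubic0)
  moreover have "B 1 = (\<alpha>3^2 * (1 - x)^2 - \<zeta>^2) / (1 - 1 / y)"
    using prod[of 1] nodes(2) nz(1) by (simp add: cubic0 eq_divide_eq mult.commute)
  moreover have "B x = (\<alpha>2^2 * (x * (x - 1))^2 - (\<zeta> * x^2)^2) / (1 - x / y)"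
    using prod[of x] nodes(3) nz(2) by (simp add: cubic0 eq_divide_eq mult.commute)
  ultimately show ?thesis using B by (simp only: C3_def)
qed

lemma tendsto_matrix2:
  assumes "(a \<longlongrightarrow> a') F" "(b \<longlongrightarrow> b') F" "(c \<longlongrightarrow> c') F" "(d \<longlongrightarrow> d') F"
  shows "((\<lambda>x. vector [vector [a x, b x], vector [c x, d x]] :: complex^2^2) \<longlongrightarrow>
    vector [vector [a', b'], vector [c', d']]) F"
proof (intro vec_tendstoI)
  fix i j :: 2
  show "((\<lambda>x. (vector [vector [a x, b x], vector [c x, d x]] :: complex^2^2) $ i $ j) \<longlongrightarrow>
    (vector [vector [a', b'], vector [c', d']] :: complex^2^2) $ i $ j) F"
    using assms exhaust_2[of i] exhaust_2[of j] by auto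
qed

lemma interpolation_limit:
  fixes a e :: complex
  assumes "a \<noteq> 0" "a \<noteq> 1"
  shows "l * cubic a t
     + \<alpha>1^2 * a^2 * (t - 1) * (t - a) / a
     + (\<alpha>3^2 * (1 - a)^2 - e^2) / (1 - 0) * t * (t - a) / (1 - a)
     + (\<alpha>2^2 * (a * (a - 1))^2 - (e * a^2)^2) / (1 - a * 0) * t * (t - 1) / (a * (a - 1))
     = limit_numerator \<alpha>1 \<alpha>2 \<alpha>3 a e l t"
proof -
  have "a * (a - 1) * (l * cubic a t) + \<alpha>1^2 * a^2 * (t - 1) * (t - a) * (a - 1)
     - (\<alpha>3^2 * (1 - a)^2 - e^2) * t * (t - a) * a
     + (\<alpha>2^2 * (a * (a - 1))^2 - (e * a^2)^2) * t * (t - 1)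
    = a * (a - 1) * limit_numerator \<alpha>1 \<alpha>2 \<alpha>3 a e l t"
    unfolding limit_numerator_def cubic_def by algebra
  then have "limit_numerator \<alpha>1 \<alpha>2 \<alpha>3 a e l t
    = (a * (a - 1) * (l * cubic a t) + \<alpha>1^2 * a^2 * (t - 1) * (t - a) * (a - 1)
     - (\<alpha>3^2 * (1 - a)^2 - e^2) * t * (t - a) * a
     + (\<alpha>2^2 * (a * (a - 1))^2 - (e * a^2)^2) * t * (t - 1)) / (a * (a - 1))"
    using assms by (simp add: eq_divide_eq mult.commute)
  also have "\<dots> = l * cubic a t + \<alpha>1^2 * a^2 * (t - 1) * (t - a) / a
     - (\<alpha>3^2 * (1 - a)^2 - e^2) * t * (t - a) / (a - 1)
     + (\<alpha>2^2 * (a * (a - 1))^2 - (e * a^2)^2) * t * (t - 1) / (a * (a - 1))"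
    using assms by (simp add: add_divide_distrib diff_divide_distrib)
  also have "(\<alpha>3^2 * (1 - a)^2 - e^2) * t * (t - a) / (a - 1)
      = - ((\<alpha>3^2 * (1 - a)^2 - e^2) * t * (t - a) / (1 - a))"
    by (metis minus_diff_eq minus_divide_right)
  finally show ?thesis by simp
qed

section \<open>Convergence of the gauged system\<close>

text \<open>
  The square root normalizes the upper right numerator \<open>k (t - y)\<close> to \<open>1 - t / y\<close>, which
  tends to 1 as \<open>y \<rightarrow> \<infinity>\<close>; the lower left entry, linear in \<open>t\<close>, subtracts a multiple
  \<open>(g0 + g1 t) (t - y)\<close> from the diagonal numerator. Only the square of \<open>r\<close> enters the
  transformed system, so either root serves.
\<close>
definition regularizing_gauge ::
  "complex \<Rightarrow> complex \<Rightarrow> complex \<Rightarrow> complex \<Rightarrow> (complex poly)^2^2" where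
  "regularizing_gauge y k g0 g1 =
     (let r = csqrt (- 1 / (k * y))
      in vector [vector [[:r:], 0], vector [[:g0 / (r * k), g1 / (r * k):], [:1 / r:]]])"

lemma regularizing_gauge:
  assumes k: "k \<noteq> 0" and y: "y \<noteq> 0" and T: "T t \<noteq> (0::complex)"
    and E: "E = d t - (g0 + g1 * t) * (t - y)"
  shows "det (gauge_matrix 0 s (regularizing_gauge y k g0 g1) w) = 1"
    and "gauge_transform (gauge_matrix 0 s (regularizing_gauge y k g0 g1))
        (\<lambda>t. vector [vector [d t / T t, k * (t - y) / T t], vector [n t / T t, - (d t / T t)]]) t
      = vector [vector [E / T t, (1 - t / y) / T t],
          vector [- y * (2 * (g0 + g1 * t) * d t + k * n t - (g0 + g1 * t)^2 * (t - y) + g1 * T t) / T t,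
            - (E / T t)]]"
proof -
  define r where "r = csqrt (- 1 / (k * y))"
  have r2: "r^2 = - 1 / (k * y)" by (simp add: r_def)
  then have r: "r \<noteq> 0" using k y by auto
  note gauge = gauge_transform_lower_triangular[OF r, of s "g0 / (r * k)" "g1 / (r * k)"]
  show "det (gauge_matrix 0 s (regularizing_gauge y k g0 g1) w) = 1"
    using gauge(1) by (simp add: regularizing_gauge_def Let_def r_def)
  define h i where "h = g0 + g1 * t" and "i = 1 / T t"
  define ir ik where "ir = 1 / r" and "ik = 1 / k"
  have inv: "r * ir = 1" "k * ik = 1" using r k by (simp_all add: ir_def ik_def)
  have "r^2 * k * y = - 1" using r2 k y by simp
  then have ky: "ir^2 = - k * y" using inv by algebra
  have i: "i * T t = 1" using T by (simp add: i_def)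
  have f: "g0 / (r * k) + g1 / (r * k) * t = h * ir * ik"
    by (simp add: h_def ir_def ik_def add_divide_distrib)
  have 11: "d t * i - r * (h * ir * ik) * (k * (t - y) * i) = E * i"
    unfolding E h_def[symmetric] using inv by algebra
  have 12: "r^2 * (k * (t - y) * i) = (1 - t / y) * i"
  proof -
    have "r^2 * k * y = - 1" by fact
    then have "(r^2 * (k * (t - y) * i)) * y = (y - t) * i" by algebra
    also have "\<dots> = (1 - t / y) * i * y" using y by (simp add: algebra_simps)
    finally show ?thesis using y by simp
  qed
  have 21: "2 * (h * ir * ik * ir) * (d t * i) + n t * i * ir^2 - (h * ir * ik)^2 * (k * (t - y) * i)
      + g1 * ir * ik * ir = - y * (2 * h * d t + k * n t - h^2 * (t - y) + g1 * T t) * i"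
  proof -
    have y': "ir^2 * ik = - y" using ky inv(2) by algebra
    have 1: "2 * (h * ir * ik * ir) * (d t * i) = 2 * h * (- y) * (d t * i)"
      unfolding y'[symmetric] by (simp add: power2_eq_square)
    have "(h * ir * ik)^2 * (k * (t - y) * i) = h^2 * (ir^2 * ik) * (k * ik) * (t - y) * i"
      by (simp add: power2_eq_square)
    then have 2: "(h * ir * ik)^2 * (k * (t - y) * i) = h^2 * (- y) * (t - y) * i"
      unfolding y' inv(2) by simp
    have "g1 * ir * ik * ir = g1 * (ir^2 * ik) * (i * T t)"
      using i by (simp add: power2_eq_square)
    then have 3: "g1 * ir * ik * ir = g1 * (- y) * (i * T t)" unfolding y' .
    show ?thesis unfolding 1 2 3 ky by (simp add: algebra_simps)
  qed
  have "gauge_transform (gauge_matrix 0 s (regularizing_gauge y k g0 g1))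
        (\<lambda>t. vector [vector [d t / T t, k * (t - y) / T t], vector [n t / T t, - (d t / T t)]]) t
      = vector [vector [d t * i - r * (h * ir * ik) * (k * (t - y) * i), r^2 * (k * (t - y) * i)],
          vector [2 * (h * ir * ik * ir) * (d t * i) + n t * i * ir^2 - (h * ir * ik)^2 * (k * (t - y) * i)
            + g1 * ir * ik * ir, - (d t * i - r * (h * ir * ik) * (k * (t - y) * i))]]"
    unfolding regularizing_gauge_def Let_def r_def[symmetric] gauge(2) f
    by (simp add: i_def ir_def ik_def power_divide)
  then show "gauge_transform (gauge_matrix 0 s (regularizing_gauge y k g0 g1))
        (\<lambda>t. vector [vector [d t / T t, k * (t - y) / T t], vector [n t / T t, - (d t / T t)]]) t
      = vector [vector [E / T t, (1 - t / y) / T t],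
          vector [- y * (2 * (g0 + g1 * t) * d t + k * n t - (g0 + g1 * t)^2 * (t - y) + g1 * T t) / T t,
            - (E / T t)]]"
    unfolding 11 12 21 by (simp add: h_def i_def)
qed

lemma large_at_pole:
  assumes y: "filterlim y at_infinity (at (a::complex))"
  shows "\<forall>\<^sub>F x in at a. y x \<notin> {0, 1, x}"
proof -
  have id: "((\<lambda>x. x) \<longlongrightarrow> a) (at a)" by simp
  have "\<forall>r>0. \<forall>\<^sub>F x in at a. r \<le> norm (y x)"
    using y filterlim_at_infinity[of 0 y "at a"] by simp
  moreover have "norm a + 2 > 0" using norm_ge_zero[of a] by linarith
  ultimately have "\<forall>\<^sub>F x in at a. norm a + 2 \<le> norm (y x)" by blast
  moreover have "\<forall>\<^sub>F x in at a. norm x < norm a + 1"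
    using tendsto_norm[OF id] by (rule order_tendstoD) simp
  ultimately show "\<forall>\<^sub>F x in at a. y x \<notin> {0, 1, x}"
  proof eventually_elim
    case (elim x)
    then have "norm (y x) > 1" "norm (y x) > norm x" using norm_ge_zero[of a] by linarith+
    then show ?case by auto
  qed
qed

text \<open>
  The diagonal numerator has the value \<open>z\<close> at \<open>t = y\<close>, so a gauge with linear entries replaces
  it by any polynomial of degree at most 2 with that value there. The choice \<open>\<zeta> t\<^sup>2\<close> with \<open>\<zeta> = z / y\<^sup>2\<close> stays bounded at a pole of
  either order and for both signs of the residue, so one gauge covers all cases. What remains
  is to control \<open>\<zeta>\<close> and the leading coefficient \<open>y (\<zeta> + \<delta>) (\<zeta> + 1 - \<delta>)\<close>.
\<close>
lemma schlesinger_limitI: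
  fixes y :: "complex \<Rightarrow> complex"
  defines "\<zeta> \<equiv> \<lambda>x. z_of y x / (y x)^2"
  assumes a: "a \<noteq> 0" "a \<noteq> 1"
    and ev: "\<forall>\<^sub>F x in at a. x \<in> S"
    and y: "filterlim y at_infinity (at a)"
    and sys: "associated_system \<delta> \<alpha>1 \<alpha>2 \<alpha>3 S y A"
    and \<zeta>: "(\<zeta> \<longlongrightarrow> e) (at a)"
    and l: "((\<lambda>x. y x * (\<zeta> x + \<delta>) * (\<zeta> x + 1 - \<delta>)) \<longlongrightarrow> l) (at a)"
  shows "schlesinger_limit A a (limit_matrix \<alpha>1 \<alpha>2 \<alpha>3 a e l)"
proof -
  obtain \<kappa> p N where \<kappa>: "kappa_solution_on \<delta> y S \<kappa>" and A: "A = A_matrix \<delta> y \<kappa> p N"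
    and ass: "\<And>x. x \<in> S \<Longrightarrow> y x \<notin> {0, 1, x} \<Longrightarrow>
           degree (N x) \<le> 1 \<and>
           eigenvalues (residue_matrix (A x) 0) = {\<alpha>1, - \<alpha>1} \<and>
           eigenvalues (residue_matrix (A x) x) = {\<alpha>2, - \<alpha>2} \<and>
           eigenvalues (residue_matrix (A x) 1) = {\<alpha>3, - \<alpha>3}"
    using sys unfolding associated_system_def by blast
  have id: "((\<lambda>x. x) \<longlongrightarrow> a) (at a)" by simp
  have good: "\<forall>\<^sub>F x in at a. y x \<notin> {0, 1, x}" using y by (rule large_at_pole)
  have x0: "\<forall>\<^sub>F x in at a. x \<noteq> 0" "\<forall>\<^sub>F x in at a. x \<noteq> 1"
    using tendsto_imp_eventually_ne[OF id] a by auto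
  define g0 g1 where "g0 x = \<delta> * y x + p x - \<zeta> x * y x" and "g1 x = - \<delta> - \<zeta> x" for x
  define P where "P x = regularizing_gauge (y x) (\<kappa> x) (g0 x) (g1 x)" for x
  define d where "d x t = - \<delta> * (t - y x)^2 + p x * (t - y x) + z_of y x" for x t
  define B where "B x t = y x * (\<zeta> x + \<delta>) * (\<zeta> x + 1 - \<delta>) * cubic x t
     + \<alpha>1^2 * x^2 * (t - 1) * (t - x) / x
     + (\<alpha>3^2 * (1 - x)^2 - (\<zeta> x)^2) / (1 - 1 / y x) * t * (t - x) / (1 - x)
     + (\<alpha>2^2 * (x * (x - 1))^2 - (\<zeta> x * x^2)^2) / (1 - x / y x) * t * (t - 1) / (x * (x - 1))" for x t
  have A': "A x = (\<lambda>t. vector [vector [d x t / cubic x t, \<kappa> x * (t - y x) / cubic x t],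
      vector [poly (N x) t / cubic x t, - (d x t / cubic x t)]])" for x
    unfolding A by (rule ext) (simp add: A_matrix_def Let_def d_def cubic_def)
  have transformed: "gauge_transform (gauge_matrix 0 s (P x)) (A x) t =
      vector [vector [\<zeta> x * t^2 / cubic x t, (1 - t / y x) / cubic x t],
        vector [B x t / cubic x t, - (\<zeta> x * t^2 / cubic x t)]]"
    if x: "x \<in> S" "y x \<notin> {0, 1, x}" "x \<noteq> 0" "x \<noteq> 1" and T: "cubic x t \<noteq> 0" for x t s
  proof -
    have z: "z_of y x = \<zeta> x * (y x)^2" using x by (simp add: \<zeta>_def)
    define n0 n1 where "n0 = coeff (N x) 0" and "n1 = coeff (N x) 1"
    have deg: "degree (N x) \<le> 1" using ass x by blast
    have "coeff (N x) m = coeff [:n0, n1:] m" for m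
    proof (cases "m \<le> 1")
      case True
      then show ?thesis by (auto simp: n0_def n1_def le_Suc_eq)
    next
      case False
      then have "coeff [:n0, n1:] m = 0" by (intro coeff_eq_0) (simp add: degree_pCons_eq_if)
      then show ?thesis using False deg by (simp add: coeff_eq_0)
    qed
    then have "N x = [:n0, n1:]" by (rule poly_eqI)
    then have N: "poly (N x) u = n0 + n1 * u" for u by (simp add: mult.commute)
    have k: "\<kappa> x \<noteq> 0" using \<kappa> x by (simp add: kappa_solution_on_def)
    have y0: "y x \<noteq> 0" using x by simp
    have nodes: "(d x 0)^2 + \<kappa> x * (0 - y x) * n0 = \<alpha>1^2 * x^2"
      "(d x 1)^2 + \<kappa> x * (1 - y x) * (n0 + n1) = \<alpha>3^2 * (1 - x)^2"
      "(d x x)^2 + \<kappa> x * (x - y x) * (n0 + n1 * x) = \<alpha>2^2 * (x * (x - 1))^2"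
      using A_matrix_residue_determinant[of \<delta> y \<kappa> p N x 0 \<alpha>1]
        A_matrix_residue_determinant[of \<delta> y \<kappa> p N x 1 \<alpha>3]
        A_matrix_residue_determinant[of \<delta> y \<kappa> p N x x \<alpha>2] ass[OF x(1,2)] x(3,4)
      by (simp_all add: A cubic_def N d_def)
    have "\<zeta> x * t^2 = d x t - (g0 x + g1 x * t) * (t - y x)"
      unfolding d_def z g0_def g1_def by algebra
    note gauged = regularizing_gauge(2)[of "\<kappa> x" "y x" "cubic x" t "\<zeta> x * t^2" "d x" "g0 x" "g1 x" s "poly (N x)",
        OF k y0 T this]
    have numerator: "- y x * (2 * (g0 x + g1 x * t) * d x t + \<kappa> x * poly (N x) t - (g0 x + g1 x * t)^2 * (t - y x)
      + g1 x * cubic x t) = B x t"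
      using gauged_numerator_interpolation[of x "y x" \<delta> "p x" "\<zeta> x" "\<kappa> x" n0 \<alpha>1 n1 \<alpha>3 \<alpha>2 t] x nodes
      by (simp add: N B_def g0_def g1_def d_def z)
    from gauged[unfolded numerator] show ?thesis unfolding A' P_def .
  qed
  show ?thesis unfolding schlesinger_limit_def
  proof (intro bexI[of _ 0] exI[of _ P] conjI allI impI ballI)
    show "\<forall>\<^sub>F x in at a. \<forall>D s. sqrt_branch D s \<longrightarrow> (\<forall>t\<in>D. det (gauge_matrix 0 s (P x) t) = 1)"
      using ev good
    proof eventually_elim
      case (elim x)
      have "\<kappa> x \<noteq> 0" "y x \<noteq> 0" using \<kappa> elim by (simp_all add: kappa_solution_on_def)
      then show ?case using regularizing_gauge(1)[of "\<kappa> x" "y x" "\<lambda>_. 1" _ _ "\<lambda>_. _"]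
        by (simp add: P_def)
    qed
    fix D s t assume "sqrt_branch D s" "t \<in> D - {1, a}"
    then have "t \<noteq> 0" "t \<noteq> 1" "t \<noteq> a" by (auto simp: sqrt_branch_def)
    then have T0: "cubic a t \<noteq> 0" by (simp add: cubic_def)
    have cubic: "((\<lambda>x. cubic x t) \<longlongrightarrow> cubic a t) (at a)"
      unfolding cubic_def by (intro tendsto_intros)
    have inv: "((\<lambda>x. 1 / y x) \<longlongrightarrow> 0) (at a)"
      using y by (intro tendsto_divide_0[OF tendsto_const])
    have b: "((\<lambda>x. c x / y x) \<longlongrightarrow> c' * 0) (at a)" if "(c \<longlongrightarrow> c') (at a)" for c c'
      using tendsto_mult[OF that inv] by simp
    have "((\<lambda>x. B x t) \<longlongrightarrow> l * cubic a t
     + \<alpha>1^2 * a^2 * (t - 1) * (t - a) / a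
     + (\<alpha>3^2 * (1 - a)^2 - e^2) / (1 - 0) * t * (t - a) / (1 - a)
     + (\<alpha>2^2 * (a * (a - 1))^2 - (e * a^2)^2) / (1 - a * 0) * t * (t - 1) / (a * (a - 1))) (at a)"
      unfolding B_def using a by (intro tendsto_intros b l \<zeta> cubic inv) auto
    then have B: "((\<lambda>x. B x t) \<longlongrightarrow> limit_numerator \<alpha>1 \<alpha>2 \<alpha>3 a e l t) (at a)"
      unfolding interpolation_limit[OF a] .
    have "((\<lambda>x. (1 - t / y x)) \<longlongrightarrow> 1 - t * 0) (at a)" by (intro tendsto_intros b)
    then have b1: "((\<lambda>x. (1 - t / y x)) \<longlongrightarrow> 1) (at a)" by simp
    have "((\<lambda>x. vector [vector [\<zeta> x * t^2 / cubic x t, (1 - t / y x) / cubic x t],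
        vector [B x t / cubic x t, - (\<zeta> x * t^2 / cubic x t)]] :: complex^2^2)
      \<longlongrightarrow> limit_matrix \<alpha>1 \<alpha>2 \<alpha>3 a e l t) (at a)"
      unfolding limit_matrix_def by (intro tendsto_matrix2 tendsto_intros \<zeta> cubic T0 b1 B)
    moreover have "\<forall>\<^sub>F x in at a. vector [vector [\<zeta> x * t^2 / cubic x t, (1 - t / y x) / cubic x t],
        vector [B x t / cubic x t, - (\<zeta> x * t^2 / cubic x t)]]
      = gauge_transform (gauge_matrix 0 s (P x)) (A x) t"
      using ev good x0 tendsto_imp_eventually_ne[OF cubic T0]
      by eventually_elim (simp add: transformed)
    ultimately show "((\<lambda>x. gauge_transform (gauge_matrix 0 s (P x)) (A x) t) \<longlongrightarrow>
        limit_matrix \<alpha>1 \<alpha>2 \<alpha>3 a e l t) (at a)"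
      by (rule Lim_transform_eventually)
  qed simp
qed

section \<open>Leading behaviour of a solution at a pole\<close>

text \<open>
  The two leading Laurent coefficients are the value and the derivative at \<open>a\<close> of the
  holomorphic factor; the types and parameters of poles are read off from them.
\<close>
lemma pole_factorization:
  fixes y :: "complex \<Rightarrow> complex"
  assumes "y holomorphic_on S" "open S" and ev: "\<forall>\<^sub>F x in at a. x \<in> S" and pole: "is_pole y a"
  obtains h n r where "n > 0" "r > 0" "h holomorphic_on ball a r" "h a \<noteq> 0"
    "\<And>x. x \<in> ball a r - {a} \<Longrightarrow> x \<in> S \<and> y x = h x / (x - a)^n \<and> h x \<noteq> 0"
    "fls_nth (laurent_expansion y a) (- int n) = h a"
    "fls_nth (laurent_expansion y a) (1 - int n) = deriv h a"
proof -
  obtain \<rho> where \<rho>: "\<rho> > 0" "ball a \<rho> - {a} \<subseteq> S"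
    using ev by (auto simp: eventually_at subset_iff dist_commute)
  define h where "h = zor_poly y a"
  have hol: "y holomorphic_on ball a \<rho> - {a}" using assms(1) \<rho>(2) by (rule holomorphic_on_subset)
  obtain r where n: "zorder y a < 0" and r: "h a \<noteq> 0" "r > 0" "cball a r \<subseteq> ball a \<rho>" "h holomorphic_on cball a r"
    and fact: "\<And>w. w \<in> cball a r - {a} \<Longrightarrow> y w = h w / (w - a) ^ nat (- zorder y a) \<and> h w \<noteq> 0"
    using zorder_exist_pole[OF hol _ _ pole] \<rho>(1) unfolding h_def by auto
  define m where "m = nat (- zorder y a)"
  have m: "zorder y a = - int m" "m > 0" using n by (simp_all add: m_def)
  have facts: "x \<in> S \<and> y x = h x / (x - a)^m \<and> h x \<noteq> 0" if "x \<in> ball a r - {a}" for x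
  proof -
    have "x \<in> cball a r - {a}" using that by auto
    moreover from this have "x \<in> S" using r(3) \<rho>(2) by blast
    ultimately show ?thesis using fact[of x] by (simp add: m_def)
  qed
  have "\<not> (\<forall>\<^sub>F x in at a. y x = 0)"
  proof
    assume "\<forall>\<^sub>F x in at a. y x = 0"
    moreover have "\<forall>\<^sub>F x in at a. y x \<noteq> 0" using pole by (rule non_zero_neighbour_pole)
    ultimately have "\<forall>\<^sub>F x in at a. False" by eventually_elim simp
    then show False by simp
  qed
  then have L: "laurent_expansion y a = fls_shift (int m) (fps_to_fls (fps_expansion h a))"
    by (simp add: laurent_expansion_def h_def m)
  show ?thesis
  proof (rule that[of m r h])
    show "h holomorphic_on ball a r" using r(4) by (rule holomorphic_on_subset) auto
    show "fls_nth (laurent_expansion y a) (- int m) = h a"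
      "fls_nth (laurent_expansion y a) (1 - int m) = deriv h a"
      by (simp_all add: L fps_expansion_def)
  qed (use m r facts in auto)
qed

lemma factorized_derivatives:
  assumes h: "h holomorphic_on ball a r"
    and y: "\<And>x. x \<in> ball a r - {a} \<Longrightarrow> y x = h x / (x - a)^n" and x: "x \<in> ball a r - {a}"
  shows "deriv y x = (deriv h x * (x - a) - of_nat n * h x) / (x - a)^(n + 1)"
    and "deriv (deriv y) x = (deriv (deriv h) x * (x - a)^2 - 2 * of_nat n * deriv h x * (x - a)
      + of_nat n * (of_nat n + 1) * h x) / (x - a)^(n + 2)"
proof -
  have hD: "(h has_field_derivative deriv h x) (at x)" if "x \<in> ball a r" for x
    using h that by (intro holomorphic_derivI[of _ "ball a r"]) auto
  have "deriv h holomorphic_on ball a r" using h by (rule holomorphic_deriv) simp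
  then have hDD: "(deriv h has_field_derivative deriv (deriv h) x) (at x)" if "x \<in> ball a r" for x
    using that by (intro holomorphic_derivI[of _ "ball a r"]) auto
  have opn: "open (ball a r - {a})" by (intro open_delete open_ball)
  have pow: "((\<lambda>x. (x - a)^m) has_field_derivative of_nat m * (x - a)^m / (x - a)) (at x)"
    if "x \<noteq> a" for m x
  proof -
    have "((\<lambda>x. x - a) has_field_derivative 1) (at x)" by (auto intro!: derivative_eq_intros)
    then have "((\<lambda>x. (x - a)^m) has_field_derivative of_nat m * (1 * (x - a)^(m - Suc 0))) (at x)"
      by (rule DERIV_power)
    moreover have "of_nat m * (1 * (x - a)^(m - Suc 0)) = of_nat m * (x - a)^m / (x - a)"
      using that by (cases m) simp_all
    ultimately show ?thesis by simp
  qed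
  have D1: "deriv y x = (deriv h x * (x - a) - of_nat n * h x) / (x - a)^(n + 1)"
    if x: "x \<in> ball a r - {a}" for x
  proof (rule DERIV_imp_deriv, rule has_field_derivative_transform_within_open[OF _ opn x])
    have "x \<in> ball a r" "x \<noteq> a" using x by auto
    then show "((\<lambda>x. h x / (x - a)^n) has_field_derivative
        (deriv h x * (x - a) - of_nat n * h x) / (x - a)^(n + 1)) (at x)"
      by - ((rule derivative_eq_intros hD pow refl | simp)+, simp add: field_simps)
  qed (use y in simp)
  have D2: "deriv (deriv y) x = ((deriv (deriv h) x * (x - a) + deriv h x - of_nat n * deriv h x) * (x - a)^(n + 1)
        - (deriv h x * (x - a) - of_nat n * h x) * (of_nat (n + 1) * (x - a)^(n + 1) / (x - a)))
       / ((x - a)^(n + 1) * (x - a)^(n + 1))"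
  proof (rule DERIV_imp_deriv, rule has_field_derivative_transform_within_open[OF _ opn x])
    have "x \<in> ball a r" "x \<noteq> a" using x by auto
    then show "((\<lambda>x. (deriv h x * (x - a) - of_nat n * h x) / (x - a)^(n + 1)) has_field_derivative
        ((deriv (deriv h) x * (x - a) + deriv h x - of_nat n * deriv h x) * (x - a)^(n + 1)
        - (deriv h x * (x - a) - of_nat n * h x) * (of_nat (n + 1) * (x - a)^(n + 1) / (x - a)))
       / ((x - a)^(n + 1) * (x - a)^(n + 1))) (at x)"
      by - ((rule derivative_eq_intros hD hDD pow refl | simp)+)
  qed (use D1 in simp)
  define s where "s = x - a"
  have s: "s \<noteq> 0" using x by (simp add: s_def)
  have "((h2 * s + h1 - N * h1) * s^(n + 1) - (h1 * s - N * h0) * ((N + 1) * s^(n + 1) / s))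
       / (s^(n + 1) * s^(n + 1))
     = (h2 * s^2 - 2 * N * h1 * s + N * (N + 1) * h0) / s^(n + 2)" for h0 h1 h2 N
    using s by (simp add: divide_simps) (simp add: algebra_simps power2_eq_square)
  from this[of "deriv (deriv h) x" "deriv h x" "of_nat n" "h x"]
  show "deriv (deriv y) x = (deriv (deriv h) x * (x - a)^2 - 2 * of_nat n * deriv h x * (x - a)
      + of_nat n * (of_nat n + 1) * h x) / (x - a)^(n + 2)"
    unfolding D2 by (simp add: s_def add.commute)
  show "deriv y x = (deriv h x * (x - a) - of_nat n * h x) / (x - a)^(n + 1)" using x by (rule D1)
qed

lemma eventually_punctured_ball:
  fixes a :: "'a::metric_space"
  assumes "r > 0"
  shows "\<forall>\<^sub>F x in at a. x \<in> ball a r - {a}"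
  using assms by (auto simp: eventually_at dist_commute intro!: exI[of _ r])

lemma holomorphic_on_ball_tendsto:
  assumes "f holomorphic_on ball a r" "r > 0"
  shows "(f \<longlongrightarrow> f a) (at a)"
  using assms
  by (metis centre_in_ball continuous_on_eq_continuous_at holomorphic_on_imp_continuous_on isCont_def open_ball)

text \<open>
  The equation at \<open>u = y x\<close>, multiplied by \<open>s\<^sup>2 / y\<close> and written with \<open>i = 1 / y\<close>,
  \<open>v = s y' / y\<close> and \<open>w = s\<^sup>2 y'' / y\<close>. At a pole all terms except \<open>K (s u)\<^sup>2\<close> have evident limits
  in this form.
\<close>
lemma P6_rescaled:
  fixes x s u v w i :: complex
  assumes P6: "w / (i * s^2) = 1/2 * (1 / u + 1 / (u - 1) + 1 / (u - x)) * (v / (i * s))^2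
       - (1 / x + 1 / (x - 1) + 1 / (u - x)) * (v / (i * s))
       + u * (u - 1) * (u - x) / (x^2 * (x - 1)^2) *
           (K - A * (x / u^2) + B * ((x - 1) / (u - 1)^2) - C * (x * (x - 1) / (u - x)^2))"
    and u: "u = 1 / i" and nz: "i \<noteq> 0" "1 - i \<noteq> 0" "1 - x * i \<noteq> 0" "s \<noteq> 0"
  shows "w = 1/2 * (1 + 1 / (1 - i) + 1 / (1 - x * i)) * v^2
    - (s / x + s / (x - 1) + s * i / (1 - x * i)) * v
    + (1 - i) * (1 - x * i) / (x^2 * (x - 1)^2) *
      (K * (s * u)^2 - s^2 * (A * x - B * ((x - 1) / (1 - i)^2) + C * (x * (x - 1) / (1 - x * i)^2)))"
proof -
  have u1: "u - 1 = (1 - i) / i" "u - x = (1 - x * i) / i"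
    using u nz by (simp_all add: diff_divide_distrib)
  have t1: "1/2 * (1 / u + 1 / (u - 1) + 1 / (u - x)) * (v / (i * s))^2 * (i * s^2)
      = 1/2 * (1 + 1 / (1 - i) + 1 / (1 - x * i)) * v^2"
    unfolding u1 unfolding u using nz by (simp add: divide_simps) (simp add: algebra_simps power2_eq_square)
  have vs: "v / (i * s) * (i * s^2) = v * s"
    using nz by (simp add: power2_eq_square)
  have u2: "1 / (u - x) = i / (1 - x * i)" unfolding u1 by simp
  have t2: "(1 / x + 1 / (x - 1) + 1 / (u - x)) * (v / (i * s)) * (i * s^2)
      = (s / x + s / (x - 1) + s * i / (1 - x * i)) * v"
    unfolding mult.assoc[of _ "v / (i * s)"] vs u2 by (simp add: ring_distribs mult_ac)
  have k1: "u * (u - 1) * (u - x) * (i * s^2) = (1 - i) * (1 - x * i) * (s * u)^2"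
    unfolding u1 unfolding u using nz by (simp add: divide_simps) (simp add: power2_eq_square)
  have k2: "(s * u)^2 * (x / u^2) = s^2 * x"
    "(s * u)^2 * ((x - 1) / (u - 1)^2) = s^2 * ((x - 1) / (1 - i)^2)"
    "(s * u)^2 * (x * (x - 1) / (u - x)^2) = s^2 * (x * (x - 1) / (1 - x * i)^2)"
    unfolding u1 unfolding u using nz by (simp_all add: power_mult_distrib power_divide)
  have "(s * u)^2 * (K - A * (x / u^2) + B * ((x - 1) / (u - 1)^2) - C * (x * (x - 1) / (u - x)^2))
    = K * (s * u)^2 - A * ((s * u)^2 * (x / u^2)) + B * ((s * u)^2 * ((x - 1) / (u - 1)^2))
      - C * ((s * u)^2 * (x * (x - 1) / (u - x)^2))" by (simp add: algebra_simps)
  also have "\<dots> = K * (s * u)^2 - s^2 * (A * x - B * ((x - 1) / (1 - i)^2) + C * (x * (x - 1) / (1 - x * i)^2))"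
    unfolding k2 by (simp add: algebra_simps)
  finally have k3: "(s * u)^2 * (K - A * (x / u^2) + B * ((x - 1) / (u - 1)^2) - C * (x * (x - 1) / (u - x)^2))
    = K * (s * u)^2 - s^2 * (A * x - B * ((x - 1) / (1 - i)^2) + C * (x * (x - 1) / (1 - x * i)^2))" .
  have t3: "u * (u - 1) * (u - x) / (x^2 * (x - 1)^2) *
      (K - A * (x / u^2) + B * ((x - 1) / (u - 1)^2) - C * (x * (x - 1) / (u - x)^2)) * (i * s^2)
    = (1 - i) * (1 - x * i) / (x^2 * (x - 1)^2) *
      (K * (s * u)^2 - s^2 * (A * x - B * ((x - 1) / (1 - i)^2) + C * (x * (x - 1) / (1 - x * i)^2)))"
  proof -
    have "U / X * Q * j = (V / X) * R" if "U * j = V * Y" "Y * Q = R" for U V X Y Q R j :: complex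
    proof -
      have "U / X * Q * j = (U * j) * Q / X" by simp
      also have "\<dots> = V * R / X" unfolding that(1) using that(2) by (simp add: mult.assoc)
      finally show ?thesis by simp
    qed
    from this[OF k1 k3] show ?thesis .
  qed
  have distrib: "(X - Y + Z) * k = X * k - Y * k + Z * k" for X Y Z k :: complex
    by (simp add: algebra_simps)
  have "w = w / (i * s^2) * (i * s^2)" using nz by simp
  also note P6
  also note distrib
  finally show ?thesis unfolding t1 t2 t3 .
qed

text \<open>
  For a pole of order \<open>n\<close> one has \<open>s y' / y \<rightarrow> - n\<close> and \<open>s\<^sup>2 y'' / y \<rightarrow> n (n + 1)\<close>, where
  \<open>s = x - a\<close>, so the rescaled equation says that \<open>K s\<^sup>2 y\<^sup>2 / (a\<^sup>2 (a - 1)\<^sup>2)\<close> tends to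
  \<open>n (n + 1) - 3 n\<^sup>2 / 2 = n (2 - n) / 2\<close>. For \<open>\<delta> = 1/2\<close> the constant \<open>K\<close> is 0, which forces
  \<open>n = 2\<close>. Otherwise \<open>s\<^sup>2 y\<^sup>2\<close> has a finite limit, which forces \<open>n = 1\<close> and fixes the square
  of the residue.
\<close>
lemma P6_pole_order:
  assumes a: "a \<noteq> 0" "a \<noteq> 1" and n: "n > 0" and r: "r > 0"
    and h: "h holomorphic_on ball a r" "h a \<noteq> 0"
    and y: "\<And>x. x \<in> ball a r - {a} \<Longrightarrow> y x = h x / (x - a)^n \<and> h x \<noteq> 0"
    and P6: "\<forall>\<^sub>F x in at a. P6_equation \<delta> \<alpha>1 \<alpha>2 \<alpha>3 y x"
    and pole: "filterlim y at_infinity (at a)"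
  shows "if \<delta> = 1/2 then n = 2 else n = 1 \<and> (h a)^2 * (2 * \<delta> - 1)^2 = (a * (a - 1))^2"
proof -
  define v where "v x = (deriv h x * (x - a) - of_nat n * h x) / h x" for x
  define w where "w x = (deriv (deriv h) x * (x - a)^2 - 2 * of_nat n * deriv h x * (x - a)
      + of_nat n * (of_nat n + 1) * h x) / h x" for x
  define i where "i x = 1 / y x" for x
  define K where "K = 2 * (\<delta> - 1/2)^2"
  define A where "A = 2 * \<alpha>1^2"
  define B where "B = 2 * \<alpha>3^2"
  define C where "C = 2 * (\<alpha>2^2 - 1/4)"
  define M where "M x = (1 - i x) * (1 - x * i x) / (x^2 * (x - 1)^2)" for x
  \<comment> \<open>The rescaled equation solved for the term with \<open>K\<close>.\<close>
  define E where "E x = w x - 1/2 * (1 + 1 / (1 - i x) + 1 / (1 - x * i x)) * (v x)^2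
    + ((x - a) / x + (x - a) / (x - 1) + (x - a) * i x / (1 - x * i x)) * v x
    + M x * ((x - a)^2 * (A * x - B * ((x - 1) / (1 - i x)^2) + C * (x * (x - 1) / (1 - x * i x)^2)))" for x
  have h': "deriv h holomorphic_on ball a r" using h(1) by (rule holomorphic_deriv) simp
  then have h'': "deriv (deriv h) holomorphic_on ball a r" by (rule holomorphic_deriv) simp
  note cont = holomorphic_on_ball_tendsto[OF _ r]
  note hlim = cont[OF h(1)] cont[OF h'] cont[OF h'']
  have s: "((\<lambda>x. x - a) \<longlongrightarrow> a - a) (at a)" by (intro tendsto_intros)
  then have s: "((\<lambda>x. x - a) \<longlongrightarrow> 0) (at a)" by simp
  have ilim: "(i \<longlongrightarrow> 0) (at a)"
    unfolding i_def using pole by (intro tendsto_divide_0[OF tendsto_const])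
  have "(v \<longlongrightarrow> (deriv h a * 0 - of_nat n * h a) / h a) (at a)"
    unfolding v_def by (intro tendsto_intros hlim h s)
  then have vlim: "(v \<longlongrightarrow> - of_nat n) (at a)" using h(2) by simp
  have "(w \<longlongrightarrow> (deriv (deriv h) a * 0^2 - 2 * of_nat n * deriv h a * 0
      + of_nat n * (of_nat n + 1) * h a) / h a) (at a)"
    unfolding w_def by (intro tendsto_intros hlim h s)
  then have wlim: "(w \<longlongrightarrow> of_nat n * (of_nat n + 1)) (at a)" using h(2) by simp
  have "(M \<longlongrightarrow> (1 - 0) * (1 - a * 0) / (a^2 * (a - 1)^2)) (at a)"
    unfolding M_def using a by (intro tendsto_intros ilim) auto
  then have Mlim: "(M \<longlongrightarrow> 1 / (a^2 * (a - 1)^2)) (at a)" by simp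
  have "(E \<longlongrightarrow> of_nat n * (of_nat n + 1) - 1/2 * (1 + 1 / (1 - 0) + 1 / (1 - a * 0)) * (- of_nat n)^2
    + (0 / a + 0 / (a - 1) + 0 * 0 / (1 - a * 0)) * (- of_nat n)
    + 1 / (a^2 * (a - 1)^2) * (0^2 * (A * a - B * ((a - 1) / (1 - 0)^2) + C * (a * (a - 1) / (1 - a * 0)^2)))) (at a)"
    unfolding E_def using a by (intro tendsto_intros ilim vlim wlim Mlim s) auto
  then have Elim: "(E \<longlongrightarrow> of_nat n * (of_nat n + 1) - 3 / 2 * (of_nat n)^2) (at a)" by simp
  note ball = eventually_punctured_ball[OF r, of a]
  have "((\<lambda>x. 1 - i x) \<longlongrightarrow> 1 - 0) (at a)" "((\<lambda>x. 1 - x * i x) \<longlongrightarrow> 1 - a * 0) (at a)"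
    by (intro tendsto_intros ilim)+
  then have nz: "\<forall>\<^sub>F x in at a. 1 - i x \<noteq> 0" "\<forall>\<^sub>F x in at a. 1 - x * i x \<noteq> 0"
    by (auto dest!: tendsto_imp_eventually_ne[of _ _ _ 0])
  have id: "((\<lambda>x. x) \<longlongrightarrow> a) (at a)" by simp
  have x0: "\<forall>\<^sub>F x in at a. x \<noteq> 0" "\<forall>\<^sub>F x in at a. x \<noteq> 1"
    using tendsto_imp_eventually_ne[OF id] a by auto
  have E: "\<forall>\<^sub>F x in at a. E x = M x * (K * ((x - a) * y x)^2)"
    using P6 ball nz
  proof eventually_elim
    case (elim x)
    define u where "u = y x"
    have s0: "x - a \<noteq> 0" and hx: "h x \<noteq> 0" and yx: "y x = h x / (x - a)^n" using elim y by auto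
    then have i0: "i x \<noteq> 0" and ui: "u = 1 / i x" by (auto simp: i_def u_def)
    have ix: "i x = (x - a)^n / h x" by (simp add: i_def yx)
    have d1: "deriv y x = v x / (i x * (x - a))"
      using factorized_derivatives(1)[OF h(1), of y n x] y elim hx s0
      by (simp add: v_def ix mult.commute)
    have d2: "deriv (deriv y) x = w x / (i x * (x - a)^2)"
      using factorized_derivatives(2)[OF h(1), of y n x] y elim hx s0
      by (simp add: w_def ix power2_eq_square)
    have "w x / (i x * (x - a)^2) = 1/2 * (1 / u + 1 / (u - 1) + 1 / (u - x)) * (v x / (i x * (x - a)))^2
       - (1 / x + 1 / (x - 1) + 1 / (u - x)) * (v x / (i x * (x - a)))
       + u * (u - 1) * (u - x) / (x^2 * (x - 1)^2) *
           (K - A * (x / u^2) + B * ((x - 1) / (u - 1)^2) - C * (x * (x - 1) / (u - x)^2))"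
      using elim(1) unfolding P6_equation_def d1 d2 u_def K_def A_def B_def C_def .
    from P6_rescaled[OF this ui i0 elim(3,4) s0]
    show ?case unfolding E_def M_def[symmetric] u_def by (simp add: algebra_simps)
  qed
  show ?thesis
  proof (cases "\<delta> = 1/2")
    case True
    have "K = 0" unfolding K_def True by simp
    then have "\<forall>\<^sub>F x in at a. E x = 0" using E by simp
    then have "(E \<longlongrightarrow> 0) (at a)" by (rule tendsto_eventually)
    then have "of_nat n * (of_nat n + 1) - 3 / 2 * (of_nat n)^2 = (0::complex)"
      using Elim by (intro tendsto_unique[of "at a"]) auto
    then have "of_nat n * (of_nat 2 - of_nat n) = (0::complex)" by (simp add: algebra_simps power2_eq_square)
    then have "n = 2" using n by (auto simp del: of_nat_numeral)
    then show ?thesis using True by simp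
  next
    case False
    then have K: "K \<noteq> 0" by (simp add: K_def)
    define L :: complex where "L = of_nat n * (of_nat n + 1) - 3 / 2 * (of_nat n)^2"
    have "((\<lambda>x. E x / (M x * K)) \<longlongrightarrow> L / (1 / (a^2 * (a - 1)^2) * K)) (at a)"
      using a K unfolding L_def by (intro tendsto_intros Elim Mlim) auto
    moreover have "\<forall>\<^sub>F x in at a. E x / (M x * K) = ((x - a) * y x)^2"
      using E nz x0 by eventually_elim (use K in \<open>simp add: M_def\<close>)
    ultimately have sy: "((\<lambda>x. ((x - a) * y x)^2) \<longlongrightarrow> L / (1 / (a^2 * (a - 1)^2) * K)) (at a)"
      by (rule Lim_transform_eventually)
    have "\<forall>\<^sub>F x in at a. ((x - a)^(n - 1))^2 * ((x - a) * y x)^2 = (h x)^2"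
      using ball
    proof eventually_elim
      case (elim x)
      then have "(x - a)^(n - 1) * ((x - a) * y x) = h x"
        using y[OF elim] n power_minus_mult[OF n, of "x - a"] by (simp add: mult.assoc[symmetric])
      then show ?case by (metis power_mult_distrib)
    qed
    moreover have "((\<lambda>x. ((x - a)^(n - 1))^2 * ((x - a) * y x)^2) \<longlongrightarrow>
        (0^(n - 1))^2 * (L / (1 / (a^2 * (a - 1)^2) * K))) (at a)"
      by (intro tendsto_intros s sy)
    ultimately have "((\<lambda>x. (h x)^2) \<longlongrightarrow> (0^(n - 1))^2 * (L / (1 / (a^2 * (a - 1)^2) * K))) (at a)"
      by (rule Lim_transform_eventually[rotated])
    moreover have "((\<lambda>x. (h x)^2) \<longlongrightarrow> (h a)^2) (at a)" by (intro tendsto_intros hlim)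
    ultimately have eq: "(h a)^2 = (0^(n - 1))^2 * (L / (1 / (a^2 * (a - 1)^2) * K))"
      by (intro tendsto_unique[of "at a"]) auto
    have n1: "n = 1"
    proof (rule ccontr)
      assume "n \<noteq> 1"
      then have "n - 1 \<noteq> 0" using n by simp
      then have "(h a)^2 = 0" unfolding eq by (simp add: power_0_left)
      then show False using h(2) by simp
    qed
    then have "(h a)^2 * (2 * K) = a^2 * (a - 1)^2"
      using eq K by (simp add: L_def field_simps)
    then have "(h a)^2 * (2 * K) = (a * (a - 1))^2" by (simp add: power_mult_distrib)
    moreover have "2 * K = (2 * \<delta> - 1)^2" by (simp add: K_def power2_eq_square algebra_simps)
    ultimately show ?thesis using False n1 by simp
  qed
qed

text \<open>
  The limit of \<open>\<zeta> = z / y\<^sup>2\<close>: it is \<open>- \<delta>\<close> at poles of type 1, double poles included, and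
  \<open>\<delta> - 1\<close> at poles of type \<open>- 1\<close>.
\<close>
definition leading_exponent :: "complex \<Rightarrow> complex \<Rightarrow> complex" where
  "leading_exponent \<delta> \<sigma> = - 1/2 - \<sigma> * (\<delta> - 1/2)"

text \<open>
  The limit of \<open>y (\<zeta> + \<delta>) (\<zeta> + 1 - \<delta>)\<close>. This is the only place where the free parameter
  \<open>c\<close> of the Laurent expansion enters.
\<close>
definition cubic_coefficient :: "complex \<Rightarrow> complex \<Rightarrow> complex \<Rightarrow> complex \<Rightarrow> complex" where
  "cubic_coefficient \<delta> a \<sigma> c =
     (if \<delta> = 1/2 then (a * (a - 1))^2 / c
      else - \<sigma> * (2 * \<delta> - 1) * (1 - a) - (2 * \<delta> - 1)^2 * c)"

text \<open>
  Here \<open>\<zeta> = (U - 1) / 2\<close> with \<open>U\<close> holomorphic at \<open>a\<close> and \<open>U a = - \<sigma> (2 \<delta> - 1)\<close>. Hence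
  \<open>(\<zeta> + \<delta>) (\<zeta> + 1 - \<delta>) = (U\<^sup>2 - (U a)\<^sup>2) / 4\<close> vanishes at \<open>a\<close>, which compensates the pole of \<open>y\<close>:
  the limit is a derivative and contains the coefficient \<open>c\<^sub>0\<close>.
\<close>
lemma simple_pole_limits:
  fixes h y :: "complex \<Rightarrow> complex"
  assumes a: "a \<noteq> 0" "a \<noteq> 1" and r: "r > 0" and h: "h holomorphic_on ball a r" "h a \<noteq> 0"
    and y: "\<And>x. x \<in> ball a r - {a} \<Longrightarrow> y x = h x / (x - a) \<and> h x \<noteq> 0"
    and res: "h a = \<sigma> * (a * (a - 1)) / (2 * \<delta> - 1)" "\<sigma>^2 = 1" and \<delta>: "\<delta> \<noteq> 1/2"
  defines "\<zeta> \<equiv> \<lambda>x. z_of y x / (y x)^2"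
  shows "(\<zeta> \<longlongrightarrow> leading_exponent \<delta> \<sigma>) (at a)"
    and "((\<lambda>x. y x * (\<zeta> x + \<delta>) * (\<zeta> x + 1 - \<delta>)) \<longlongrightarrow> cubic_coefficient \<delta> a \<sigma> (deriv h a)) (at a)"
proof -
  define U where "U x = (x * (x - 1) * (deriv h x * (x - a) - h x) + (x - a) * h x) / (h x)^2" for x
  have h': "deriv h holomorphic_on ball a r" using h(1) by (rule holomorphic_deriv) simp
  have hD: "(h has_field_derivative deriv h a) (at a)"
    "(deriv h has_field_derivative deriv (deriv h) a) (at a)"
    using r h(1) h' by (auto intro!: holomorphic_derivI[of _ "ball a r"])
  note ball = eventually_punctured_ball[OF r, of a]
  have d0: "2 * \<delta> - 1 \<noteq> 0" using \<delta> by (simp add: field_simps)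
  have a0: "a * (a - 1) \<noteq> 0" using a by simp
  have Ua: "U a = - (\<sigma> * (2 * \<delta> - 1))"
  proof -
    have "U a * h a = - (a * (a - 1))" using h(2) by (simp add: U_def power2_eq_square)
    then have "U a * \<sigma> * (a * (a - 1)) = - (2 * \<delta> - 1) * (a * (a - 1))"
      using d0 by (simp add: res(1) field_simps)
    then have "U a * \<sigma> = - (2 * \<delta> - 1)" using a0 by (simp only: mult_cancel_right) simp
    then have "U a * \<sigma>^2 = - (2 * \<delta> - 1) * \<sigma>" by (simp add: power2_eq_square mult.assoc[symmetric])
    then show ?thesis using res(2) by (simp add: algebra_simps)
  qed
  define U' where "U' = (2 - 2 * a) / h a + 2 * (a * (a - 1)) * deriv h a / (h a)^2"
  have UD: "(U has_field_derivative U') (at a)"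
    unfolding U_def[abs_def]
    apply (rule derivative_eq_intros hD refl)+
    subgoal using h(2) by simp
    subgoal using h(2) by (simp add: U'_def divide_simps) (simp add: algebra_simps power2_eq_square power4_eq_xxxx)
    done
  have \<zeta>U: "\<zeta> x = (U x - 1) / 2" if x: "x \<in> ball a r - {a}" for x
  proof -
    have nz: "x - a \<noteq> 0" "h x \<noteq> 0" and yx: "y x = h x / (x - a)" using x y by auto
    have dy: "deriv y x = (deriv h x * (x - a) - h x) / (x - a)^2"
      using factorized_derivatives(1)[OF h(1), of y 1 x] y x by (simp add: power2_eq_square)
    have "1/2 * (x * (x - 1) * ((d * s - k) / s^2) - (k / s)^2 + k / s) / (k / s)^2
      = ((x * (x - 1) * (d * s - k) + s * k) / k^2 - 1) / 2" if "s \<noteq> 0" "k \<noteq> 0" for d s k :: complex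
      using that by (simp add: divide_simps) (simp add: algebra_simps power2_eq_square)
    from this[OF nz] show ?thesis unfolding \<zeta>_def z_of_def U_def dy yx .
  qed
  have "(U \<longlongrightarrow> U a) (at a)" using UD DERIV_isCont isCont_def by blast
  then have "((\<lambda>x. (U x - 1) / 2) \<longlongrightarrow> (U a - 1) / 2) (at a)" by (intro tendsto_intros) auto
  moreover have "\<forall>\<^sub>F x in at a. (U x - 1) / 2 = \<zeta> x" using ball by eventually_elim (simp add: \<zeta>U)
  ultimately have "(\<zeta> \<longlongrightarrow> (U a - 1) / 2) (at a)" by (rule Lim_transform_eventually)
  moreover have "(U a - 1) / 2 = leading_exponent \<delta> \<sigma>"
    by (simp add: Ua leading_exponent_def field_simps)
  ultimately show "(\<zeta> \<longlongrightarrow> leading_exponent \<delta> \<sigma>) (at a)" by simp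
  have "((\<lambda>x. (U x)^2) has_field_derivative 2 * U a * U') (at a)"
    by (rule derivative_eq_intros UD refl)+ simp
  then have "((\<lambda>x. ((U x)^2 - (U a)^2) / (x - a)) \<longlongrightarrow> 2 * U a * U') (at a)"
    by (simp add: has_field_derivative_iff)
  moreover have "(h \<longlongrightarrow> h a) (at a)" using hD(1) DERIV_isCont isCont_def by blast
  ultimately have "((\<lambda>x. h x / 4 * (((U x)^2 - (U a)^2) / (x - a))) \<longlongrightarrow> h a / 4 * (2 * U a * U')) (at a)"
    by (intro tendsto_intros) auto
  moreover have "\<forall>\<^sub>F x in at a. h x / 4 * (((U x)^2 - (U a)^2) / (x - a)) = y x * (\<zeta> x + \<delta>) * (\<zeta> x + 1 - \<delta>)"
    using ball
  proof eventually_elim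
    case (elim x)
    have "(U a)^2 = (2 * \<delta> - 1)^2" using res(2) by (simp add: Ua power_mult_distrib)
    moreover have "((u - 1) / 2 + \<delta>) * ((u - 1) / 2 + 1 - \<delta>) = (u^2 - (2 * \<delta> - 1)^2) / 4" for u
      by (simp add: field_simps power2_eq_square)
    ultimately have *: "(\<zeta> x + \<delta>) * (\<zeta> x + 1 - \<delta>) = ((U x)^2 - (U a)^2) / 4"
      unfolding \<zeta>U[OF elim] by simp
    show ?case unfolding mult.assoc[of "y x"] * using y[OF elim] by simp
  qed
  moreover have "h a / 4 * (2 * U a * U') = cubic_coefficient \<delta> a \<sigma> (deriv h a)"
  proof -
    have "h a / 4 * (2 * U a * U') = U a * ((h a * ((2 - 2 * a) / h a)
        + 2 * (a * (a - 1)) * deriv h a * (h a / (h a)^2)) / 2)"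
    proof -
      have "k / 4 * (2 * u * (p / k + 2 * X * d / k^2)) = u * ((k * (p / k) + 2 * X * d * (k / k^2)) / 2)"
        for k u p X d :: complex by (simp add: algebra_simps)
      then show ?thesis unfolding U'_def .
    qed
    also have "h a * ((2 - 2 * a) / h a) = 2 - 2 * a" using h(2) by simp
    also have "h a / (h a)^2 = 1 / h a" using h(2) by (simp add: power2_eq_square)
    also have "2 * (a * (a - 1)) * deriv h a * (1 / h a) = 2 * deriv h a * (\<sigma> * (2 * \<delta> - 1))"
    proof -
      have "\<sigma> \<noteq> 0" using res(2) by auto
      then have "a * (a - 1) / h a = (2 * \<delta> - 1) / \<sigma>" unfolding res(1) using a d0 by (simp add: field_simps)
      also have "1 / \<sigma> = \<sigma>" using res(2) \<open>\<sigma> \<noteq> 0\<close> by (simp add: divide_eq_eq power2_eq_square)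
      then have "(2 * \<delta> - 1) / \<sigma> = (2 * \<delta> - 1) * \<sigma>" by (metis divide_inverse inverse_eq_divide)
      finally have quot: "a * (a - 1) / h a = (2 * \<delta> - 1) * \<sigma>" .
      have "2 * X * d * (1 / k) = 2 * d * (X / k)" for X d k :: complex by simp
      then have "2 * (a * (a - 1)) * deriv h a * (1 / h a) = 2 * deriv h a * (a * (a - 1) / h a)" .
      then show ?thesis unfolding quot by (simp only: mult_ac)
    qed
    also have "U a * ((2 - 2 * a + 2 * deriv h a * (\<sigma> * (2 * \<delta> - 1))) / 2)
      = - (\<sigma> * (2 * \<delta> - 1)) * (1 - a + deriv h a * (\<sigma> * (2 * \<delta> - 1)))"
      unfolding Ua by (simp add: field_simps)
    also have "\<dots> = - \<sigma> * (2 * \<delta> - 1) * (1 - a) - \<sigma>^2 * (2 * \<delta> - 1)^2 * deriv h a"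
      by (simp add: algebra_simps power2_eq_square)
    finally show ?thesis using \<delta> res(2) by (simp add: cubic_coefficient_def)
  qed
  ultimately show "((\<lambda>x. y x * (\<zeta> x + \<delta>) * (\<zeta> x + 1 - \<delta>)) \<longlongrightarrow> cubic_coefficient \<delta> a \<sigma> (deriv h a)) (at a)"
    using Lim_transform_eventually by fastforce
qed

text \<open>
  Now \<open>\<zeta> + 1/2 = (x - a) V / 2\<close> with \<open>V\<close> holomorphic at \<open>a\<close>, so the two equal factors
  \<open>\<zeta> + \<delta>\<close> and \<open>\<zeta> + 1 - \<delta>\<close> compensate the double pole.
\<close>
lemma double_pole_limits:
  fixes h y :: "complex \<Rightarrow> complex"
  assumes r: "r > 0" and h: "h holomorphic_on ball a r" "h a \<noteq> 0"
    and y: "\<And>x. x \<in> ball a r - {a} \<Longrightarrow> y x = h x / (x - a)^2 \<and> h x \<noteq> 0"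
  defines "\<zeta> \<equiv> \<lambda>x. z_of y x / (y x)^2"
  shows "(\<zeta> \<longlongrightarrow> leading_exponent (1/2) \<sigma>) (at a)"
    and "((\<lambda>x. y x * (\<zeta> x + 1/2) * (\<zeta> x + 1 - 1/2)) \<longlongrightarrow> cubic_coefficient (1/2) a \<sigma> (h a)) (at a)"
proof -
  define V where "V x = (x * (x - 1) * (deriv h x * (x - a) - 2 * h x) + (x - a) * h x) / (h x)^2" for x
  have h': "deriv h holomorphic_on ball a r" using h(1) by (rule holomorphic_deriv) simp
  note cont = holomorphic_on_ball_tendsto[OF _ r]
  note ball = eventually_punctured_ball[OF r, of a]
  have s: "((\<lambda>x. x - a) \<longlongrightarrow> 0) (at a)" using LIM_offset_zero_iff[of a id a] by (intro tendsto_eq_intros) auto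
  have V: "(V \<longlongrightarrow> (a * (a - 1) * (deriv h a * 0 - 2 * h a) + 0 * h a) / (h a)^2) (at a)"
    unfolding V_def using h(2) by (intro tendsto_intros s cont h(1) h') auto
  have \<zeta>V: "\<zeta> x = ((x - a) * V x - 1) / 2" if x: "x \<in> ball a r - {a}" for x
  proof -
    have nz: "x - a \<noteq> 0" "h x \<noteq> 0" and yx: "y x = h x / (x - a)^2" using x y by auto
    have dy: "deriv y x = (deriv h x * (x - a) - 2 * h x) / (x - a)^3"
      using factorized_derivatives(1)[OF h(1), of y 2 x] y x by simp
    have "1/2 * (x * (x - 1) * ((d * s - 2 * k) / s^3) - (k / s^2)^2 + k / s^2) / (k / s^2)^2
      = (s * ((x * (x - 1) * (d * s - 2 * k) + s * k) / k^2) - 1) / 2" if "s \<noteq> 0" "k \<noteq> 0" for d s k :: complex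
      using that by (simp add: divide_simps) (simp add: algebra_simps eval_nat_numeral)
    from this[OF nz] show ?thesis unfolding \<zeta>_def z_of_def V_def dy yx .
  qed
  have "((\<lambda>x. ((x - a) * V x - 1) / 2) \<longlongrightarrow>
     (0 * ((a * (a - 1) * (deriv h a * 0 - 2 * h a) + 0 * h a) / (h a)^2) - 1) / 2) (at a)"
    by (intro tendsto_intros s V) auto
  moreover have "\<forall>\<^sub>F x in at a. ((x - a) * V x - 1) / 2 = \<zeta> x" using ball by eventually_elim (simp add: \<zeta>V)
  ultimately show "(\<zeta> \<longlongrightarrow> leading_exponent (1/2) \<sigma>) (at a)"
    using Lim_transform_eventually by (fastforce simp: leading_exponent_def)
  have "((\<lambda>x. h x * (V x)^2 / 4) \<longlongrightarrow>
     h a * ((a * (a - 1) * (deriv h a * 0 - 2 * h a) + 0 * h a) / (h a)^2)^2 / 4) (at a)"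
    by (intro tendsto_intros V cont h(1)) auto
  moreover have "\<forall>\<^sub>F x in at a. h x * (V x)^2 / 4 = y x * (\<zeta> x + 1/2) * (\<zeta> x + 1 - 1/2)"
    using ball
  proof eventually_elim
    case (elim x)
    then have s0: "x - a \<noteq> 0" and yx: "y x = h x / (x - a)^2" using y by auto
    have "k * v^2 / 4 = k / s^2 * ((s * v - 1) / 2 + 1/2) * ((s * v - 1) / 2 + 1 - 1/2)"
      if "s \<noteq> 0" for k s v :: complex
      using that by (simp add: divide_simps) (simp add: algebra_simps power2_eq_square)
    from this[OF s0] show ?case unfolding \<zeta>V[OF elim] yx .
  qed
  moreover have "h a * ((a * (a - 1) * (deriv h a * 0 - 2 * h a) + 0 * h a) / (h a)^2)^2 / 4
      = cubic_coefficient (1/2) a \<sigma> (h a)"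
    using h(2) by (simp add: cubic_coefficient_def power2_eq_square field_simps)
  ultimately show "((\<lambda>x. y x * (\<zeta> x + 1/2) * (\<zeta> x + 1 - 1/2)) \<longlongrightarrow> cubic_coefficient (1/2) a \<sigma> (h a)) (at a)"
    using Lim_transform_eventually by fastforce
qed

section \<open>Equivalence with the Heun equation\<close>

lemma pole_limits:
  fixes y :: "complex \<Rightarrow> complex"
  assumes a: "a \<notin> {0, 1}" and P6: "P6_solution_on \<delta> \<alpha>1 \<alpha>2 \<alpha>3 S y"
    and ev: "\<forall>\<^sub>F x in at a. x \<in> S" and pole: "is_pole y a"
  defines "\<zeta> \<equiv> \<lambda>x. z_of y x / (y x)^2"
  shows "(\<zeta> \<longlongrightarrow> leading_exponent \<delta> (pole_type \<delta> a y)) (at a)"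
    and "((\<lambda>x. y x * (\<zeta> x + \<delta>) * (\<zeta> x + 1 - \<delta>)) \<longlongrightarrow>
      cubic_coefficient \<delta> a (pole_type \<delta> a y) (pole_parameter \<delta> a y)) (at a)"
proof -
  have S: "open S" "y holomorphic_on S" using P6 by (auto simp: P6_solution_on_def)
  have a01: "a \<noteq> 0" "a \<noteq> 1" using a by auto
  obtain h n r where n: "n > 0" and r: "r > 0" and h: "h holomorphic_on ball a r" "h a \<noteq> 0"
    and y: "\<And>x. x \<in> ball a r - {a} \<Longrightarrow> x \<in> S \<and> y x = h x / (x - a)^n \<and> h x \<noteq> 0"
    and L: "fls_nth (laurent_expansion y a) (- int n) = h a"
      "fls_nth (laurent_expansion y a) (1 - int n) = deriv h a"
    by (rule pole_factorization[OF S(2,1) ev pole]) (rule that)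
  have inf: "filterlim y at_infinity (at a)" using pole by (simp add: is_pole_def)
  have "\<forall>\<^sub>F x in at a. P6_equation \<delta> \<alpha>1 \<alpha>2 \<alpha>3 y x"
    using ev large_at_pole[OF inf] by eventually_elim (use P6 in \<open>auto simp: P6_solution_on_def\<close>)
  then have order: "if \<delta> = 1/2 then n = 2 else n = 1 \<and> (h a)^2 * (2 * \<delta> - 1)^2 = (a * (a - 1))^2"
    using a01 n r h y inf by (intro P6_pole_order) auto
  have "(\<zeta> \<longlongrightarrow> leading_exponent \<delta> (pole_type \<delta> a y)) (at a) \<and>
    ((\<lambda>x. y x * (\<zeta> x + \<delta>) * (\<zeta> x + 1 - \<delta>)) \<longlongrightarrow>
      cubic_coefficient \<delta> a (pole_type \<delta> a y) (pole_parameter \<delta> a y)) (at a)"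
  proof (cases "\<delta> = 1/2")
    case True
    then have "n = 2" using order by simp
    moreover have "pole_parameter \<delta> a y = h a" using L(1) True \<open>n = 2\<close> by (simp add: pole_parameter_def)
    ultimately show ?thesis
      using double_pole_limits[OF r h, of y] y unfolding \<zeta>_def True by simp
  next
    case False
    then have n1: "n = 1" and sq: "(h a)^2 * (2 * \<delta> - 1)^2 = (a * (a - 1))^2" using order by simp_all
    have d0: "2 * \<delta> - 1 \<noteq> 0" using False by (simp add: field_simps)
    have type: "pole_type \<delta> a y = h a * (2 * \<delta> - 1) / (a * (a - 1))"
      using L(1) False n1 by (simp add: pole_type_def right_diff_distrib)
    have par: "pole_parameter \<delta> a y = deriv h a" using L(2) False n1 by (simp add: pole_parameter_def)
    have "h a = pole_type \<delta> a y * (a * (a - 1)) / (2 * \<delta> - 1)"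
      using a01 d0 by (simp add: type)
    moreover have "(pole_type \<delta> a y)^2 = 1"
      using sq a01 unfolding type power_divide power_mult_distrib by simp
    ultimately show ?thesis
      using simple_pole_limits[OF a01 r h, of y "pole_type \<delta> a y" \<delta>] y False n1
      unfolding \<zeta>_def par by simp
  qed
  then show "(\<zeta> \<longlongrightarrow> leading_exponent \<delta> (pole_type \<delta> a y)) (at a)"
    and "((\<lambda>x. y x * (\<zeta> x + \<delta>) * (\<zeta> x + 1 - \<delta>)) \<longlongrightarrow>
      cubic_coefficient \<delta> a (pole_type \<delta> a y) (pole_parameter \<delta> a y)) (at a)" by simp_all
qed

lemma equivalent_to_heun_at_pole:
  fixes \<delta> \<alpha>1 \<alpha>2 \<alpha>3 a :: complex and y :: "complex \<Rightarrow> complex"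
  defines "e \<equiv> leading_exponent \<delta> (pole_type \<delta> a y)"
    and "l \<equiv> cubic_coefficient \<delta> a (pole_type \<delta> a y) (pole_parameter \<delta> a y)"
  assumes a: "a \<notin> {0, 1}" and P6: "P6_solution_on \<delta> \<alpha>1 \<alpha>2 \<alpha>3 S y"
    and ev: "\<forall>\<^sub>F x in at a. x \<in> S" and pole: "is_pole y a"
    and sys: "associated_system \<delta> \<alpha>1 \<alpha>2 \<alpha>3 S y A"
  shows "equivalent_to_heun_at A a (1 + 2 * \<alpha>1) (1 + 2 * \<alpha>3) (1 + 2 * \<alpha>2)
    (\<alpha>1 + \<alpha>2 + \<alpha>3 - e) (\<alpha>1 + \<alpha>2 + \<alpha>3 + e + 2) (accessory \<alpha>1 \<alpha>2 \<alpha>3 a e l)"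
  unfolding equivalent_to_heun_at_def
proof (intro exI conjI)
  have "a \<noteq> 0" "a \<noteq> 1" "filterlim y at_infinity (at a)"
    using a pole by (simp_all add: is_pole_def)
  then show "schlesinger_limit A a (limit_matrix \<alpha>1 \<alpha>2 \<alpha>3 a e l)"
    unfolding e_def l_def by (rule schlesinger_limitI[OF _ _ ev _ sys pole_limits[OF a P6 ev pole]])
  show "\<forall>D l0 la l1.
           open D \<and> D \<inter> {0, 1, a} = {} \<and>
           log_branch D 0 l0 \<and> log_branch D a la \<and> log_branch D 1 l1 \<longrightarrow>
           bij_betw
             (\<lambda>\<Phi>. \<lambda>t\<in>D. exp (- \<alpha>1 * l0 t) * exp (- \<alpha>2 * la t) * exp (- \<alpha>3 * l1 t) * \<Phi> t $ 1)
             (system_solutions (limit_matrix \<alpha>1 \<alpha>2 \<alpha>3 a e l) D)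
             (heun_solutions a (1 + 2 * \<alpha>1) (1 + 2 * \<alpha>3) (1 + 2 * \<alpha>2)
               (\<alpha>1 + \<alpha>2 + \<alpha>3 - e) (\<alpha>1 + \<alpha>2 + \<alpha>3 + e + 2) (accessory \<alpha>1 \<alpha>2 \<alpha>3 a e l) D)"
    using limit_system_bij_heun[of _ a _ _ _ \<alpha>1 \<alpha>2 \<alpha>3 e l] by simp
qed

theorem theorem2p1:
  shows "\<exists>(\<gamma> :: complex \<Rightarrow> complex \<Rightarrow> complex \<Rightarrow> complex \<Rightarrow> complex \<Rightarrow> complex) \<eta> \<epsilon> \<alpha> \<beta>
            (q :: complex \<Rightarrow> complex \<Rightarrow> complex \<Rightarrow> complex \<Rightarrow> complex \<Rightarrow> complex \<Rightarrow> complex \<Rightarrow> complex).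
    \<forall>\<delta> \<alpha>1 \<alpha>2 \<alpha>3 a S y A.
      \<delta> \<noteq> 0 \<longrightarrow> 2 * \<alpha>1 \<notin> \<int> \<longrightarrow> 2 * \<alpha>2 \<notin> \<int> \<longrightarrow> 2 * \<alpha>3 \<notin> \<int> \<longrightarrow>
      a \<notin> {0, 1} \<longrightarrow>
      P6_solution_on \<delta> \<alpha>1 \<alpha>2 \<alpha>3 S y \<longrightarrow> (\<forall>\<^sub>F x in at a. x \<in> S) \<longrightarrow> is_pole y a \<longrightarrow>
      associated_system \<delta> \<alpha>1 \<alpha>2 \<alpha>3 S y A \<longrightarrow>
      (let \<sigma> = pole_type \<delta> a y; c = pole_parameter \<delta> a y;
           g = \<gamma> \<delta> \<alpha>1 \<alpha>2 \<alpha>3 \<sigma>; h = \<eta> \<delta> \<alpha>1 \<alpha>2 \<alpha>3 \<sigma>; e = \<epsilon> \<delta> \<alpha>1 \<alpha>2 \<alpha>3 \<sigma>;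
           b1 = \<alpha> \<delta> \<alpha>1 \<alpha>2 \<alpha>3 \<sigma>; b2 = \<beta> \<delta> \<alpha>1 \<alpha>2 \<alpha>3 \<sigma>
       in g + h + e = b1 + b2 + 1 \<and>
          equivalent_to_heun_at A a g h e b1 b2 (q \<delta> \<alpha>1 \<alpha>2 \<alpha>3 a \<sigma> c))"
proof (intro exI allI impI)
  fix \<delta> \<alpha>1 \<alpha>2 \<alpha>3 a :: complex and S y A
  assume "a \<notin> {0, 1}" "P6_solution_on \<delta> \<alpha>1 \<alpha>2 \<alpha>3 S y" "\<forall>\<^sub>F x in at a. x \<in> S" "is_pole y a"
    "associated_system \<delta> \<alpha>1 \<alpha>2 \<alpha>3 S y A"
  from equivalent_to_heun_at_pole[OF this]
  show "let \<sigma> = pole_type \<delta> a y; c = pole_parameter \<delta> a y;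
           g = (\<lambda>\<delta> \<alpha>1 \<alpha>2 \<alpha>3 \<sigma>. 1 + 2 * \<alpha>1) \<delta> \<alpha>1 \<alpha>2 \<alpha>3 \<sigma>;
           h = (\<lambda>\<delta> \<alpha>1 \<alpha>2 \<alpha>3 \<sigma>. 1 + 2 * \<alpha>3) \<delta> \<alpha>1 \<alpha>2 \<alpha>3 \<sigma>;
           e = (\<lambda>\<delta> \<alpha>1 \<alpha>2 \<alpha>3 \<sigma>. 1 + 2 * \<alpha>2) \<delta> \<alpha>1 \<alpha>2 \<alpha>3 \<sigma>;
           b1 = (\<lambda>\<delta> \<alpha>1 \<alpha>2 \<alpha>3 \<sigma>. \<alpha>1 + \<alpha>2 + \<alpha>3 - leading_exponent \<delta> \<sigma>) \<delta> \<alpha>1 \<alpha>2 \<alpha>3 \<sigma>;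
           b2 = (\<lambda>\<delta> \<alpha>1 \<alpha>2 \<alpha>3 \<sigma>. \<alpha>1 + \<alpha>2 + \<alpha>3 + leading_exponent \<delta> \<sigma> + 2) \<delta> \<alpha>1 \<alpha>2 \<alpha>3 \<sigma>
       in g + h + e = b1 + b2 + 1 \<and>
          equivalent_to_heun_at A a g h e b1 b2
            ((\<lambda>\<delta> \<alpha>1 \<alpha>2 \<alpha>3 a \<sigma> c. accessory \<alpha>1 \<alpha>2 \<alpha>3 a (leading_exponent \<delta> \<sigma>)
               (cubic_coefficient \<delta> a \<sigma> c)) \<delta> \<alpha>1 \<alpha>2 \<alpha>3 a \<sigma> c)"
    unfolding Let_def by (intro conjI) (simp_all add: algebra_simps)
qed

end
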